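(* Let $k\ge 1$ and $f\in\mathcal H_k$. For each $\ell=1,\dots,k$ define $s_\ell:=\sum_{i=1}^{\ell} g_\ell^{(i)}$, where, for $1\le i\le \ell$, \[ g_k^{(i)}(x_i)=f_k^{(i)}(x_i), \] \[ g_{k-1}^{(i)}(x_i,x_{i+1})=f_{k-1}^{(i)}(x_i,x_{i+1})-f_k^{(i)}(x_i)-f_k^{(i+1)}(x_{i+1}), \] and, for $1\le \ell\le k-2$, \[ g_\ell^{(i)}(x_i,\dots,x_{i+k-\ell})=f_\ell^{(i)}(x_i,\dots,x_{i+k-\ell})+f_{\ell+2}^{(i+1)}(x_{i+1},\dots,x_{i+k-\ell-1})-f_{\ell+1}^{(i)}(x_i,\dots,x_{i+k-\ell-1})-f_{\ell+1}^{(i+1)}(x_{i+1},\dots,x_{i+k-\ell}). \] Then $s_\ell\in\mathcal S_\ell$ for each $\ell=1,\dots,k$, and \[ f=s_1+s_2+\cdots+s_k . \] Consequently, writing $s_\ell=f_\ell+f_0^{(\ell)}$ with $f_\ell\in\mathcal L_\ell$ and $f_0^{(\ell)}\in\mathcal L_0^{(\ell)}$, one obtains the orthogonal spectral decomposition \[ f=f_0+f_1+\cdots+f_k,\qquad f_0=\sum_{\ell=1}^k f_0^{(\ell)}, \] with $f_0\in\ker B_k$ and $f_\ell\in\mathcal L_\ell$ for $1\le \ell\le k$. In particular, since $\mathcal S_1=\mathcal L_1$, one has $s_1=f_1$.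
   Context: Let $(\mathcal X,\mathcal F,\nu)$ be a probability space, $k\ge1$ an integer, $\pi_k=\nu^{\otimes k}$, and let $\mathcal H_k$ be the Hilbert space of functions $f\in L^2(\mathcal X^k,\pi_k)$ with $\int f\,d\pi_k=0$. Define the operator $P$ on $\mathcal H_k$ by \[ Pf(x_1,\dots,x_k)=\int f(x_2,\dots,x_k,\xi)\,\nu(d\xi), \] let $P^*$ be its adjoint, and let $B_k=I+P+P^*+\cdots+P^{k-1}+(P^* )^{k-1}$, a self-adjoint operator on $\mathcal H_k$. For $\ell=1,\dots,k$, $\mathcal L_\ell$ denotes the eigenspace of $B_k$ for the eigenvalue $\ell$. The subspace $\mathcal S_\ell\subset\mathcal H_k$ consists of all functions of the form \[ \phi_1(x_1,\dots,x_{k-\ell+1})+\phi_2(x_2,\dots,x_{k-\ell+2})+\cdots+\phi_\ell(x_\ell,\dots,x_k), \] where each $\phi_j\in L^2(\mathcal X^{k-\ell+1},\pi_{k-\ell+1})$ satisfies $\int\phi_j(x_1,\dots,x_{k-\ell+1})\,\nu(dx_1)=0$ and $\int\phi_j(x_1,\dots,x_{k-\ell+1})\,\nu(dx_{k-\ell+1})=0$. Put $\mathcal L_0^{(\ell)}:=\mathcal S_\ell\cap\ker B_k$. It is known (from earlier literature) that $\mathcal S_1=\mathcal L_1$ and that $\mathcal S_\ell=\mathcal L_\ell\oplus\mathcal L_0^{(\ell)}$ for $\ell>1$; in particular every element of $\mathcal S_\ell$ decomposes uniquely into an $\mathcal L_\ell$-component and an $\mathcal L_0^{(\ell)}$-component.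 For $f\in\mathcal H_k$, $1\le\ell\le k$ and $1\le i\le\ell$, the marginal $f_\ell^{(i)}(x_i,\dots,x_{i+k-\ell})$ is obtained by integrating $f(x_1,\dots,x_k)$ with respect to $\nu$ over each of the $\ell-1$ variables outside the block $x_i,\dots,x_{i+k-\ell}$ of $k-\ell+1$ consecutive variables; in particular $f_1^{(1)}=f$. The formula for $g_{k-1}^{(i)}$ applies when $k\ge2$. *)

theory Defs
  imports "HOL-Probability.Probability"
begin

text \<open>
  Elements of an $L^2$ space are represented by functions; equality in $L^2$ is equality
  almost everywhere. A point of the \<open>n\<close>-fold product space is an extensional function on the index
  set \<open>{1..n}\<close>.
\<close>

definition pow_measure :: "'a measure \<Rightarrow> nat \<Rightarrow> (nat \<Rightarrow> 'a) measure" where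
  "pow_measure \<nu> n = PiM {1..n} (\<lambda>_. \<nu>)"

definition L2 :: "'b measure \<Rightarrow> ('b \<Rightarrow> real) set" where
  "L2 M = {f. f \<in> borel_measurable M \<and> integrable M (\<lambda>x. (f x)\<^sup>2)}"

definition L2_inner :: "'b measure \<Rightarrow> ('b \<Rightarrow> real) \<Rightarrow> ('b \<Rightarrow> real) \<Rightarrow> real" where
  "L2_inner M f g = (\<integral>x. f x * g x \<partial>M)"

definition H_space :: "'a measure \<Rightarrow> nat \<Rightarrow> ((nat \<Rightarrow> 'a) \<Rightarrow> real) set" where
  "H_space \<nu> k = {f \<in> L2 (pow_measure \<nu> k). (\<integral>x. f x \<partial>pow_measure \<nu> k) = 0}"

definition P_op :: "'a measure \<Rightarrow> nat \<Rightarrow> ((nat \<Rightarrow> 'a) \<Rightarrow> real) \<Rightarrow> (nat \<Rightarrow> 'a) \<Rightarrow> real" where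
  "P_op \<nu> k f = (\<lambda>x. \<integral>\<xi>. f (\<lambda>i\<in>{1..k}. if i < k then x (i + 1) else \<xi>) \<partial>\<nu>)"

text \<open>The Hilbert space adjoint; its values are determined up to equality almost everywhere.\<close>

definition P_adj :: "'a measure \<Rightarrow> nat \<Rightarrow> ((nat \<Rightarrow> 'a) \<Rightarrow> real) \<Rightarrow> (nat \<Rightarrow> 'a) \<Rightarrow> real" where
  "P_adj \<nu> k f = (SOME h. h \<in> H_space \<nu> k \<and>
     (\<forall>g\<in>H_space \<nu> k.
        L2_inner (pow_measure \<nu> k) (P_op \<nu> k g) f = L2_inner (pow_measure \<nu> k) g h))"

definition B_op :: "'a measure \<Rightarrow> nat \<Rightarrow> ((nat \<Rightarrow> 'a) \<Rightarrow> real) \<Rightarrow> (nat \<Rightarrow> 'a) \<Rightarrow> real" where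
  "B_op \<nu> k f = (\<lambda>x. f x + (\<Sum>j\<in>{1..<k}. (P_op \<nu> k ^^ j) f x + (P_adj \<nu> k ^^ j) f x))"

definition ker_B :: "'a measure \<Rightarrow> nat \<Rightarrow> ((nat \<Rightarrow> 'a) \<Rightarrow> real) set" where
  "ker_B \<nu> k = {f \<in> H_space \<nu> k. AE x in pow_measure \<nu> k. B_op \<nu> k f x = 0}"

definition L_space :: "'a measure \<Rightarrow> nat \<Rightarrow> nat \<Rightarrow> ((nat \<Rightarrow> 'a) \<Rightarrow> real) set" where
  "L_space \<nu> k l = {f \<in> H_space \<nu> k. AE x in pow_measure \<nu> k. B_op \<nu> k f x = real l * f x}"

text \<open>
  The two integral conditions hold for almost every value of the remaining variables. They are
  stated for almost every \<open>y\<close>; the component of \<open>y\<close> that is overwritten by \<open>\<xi>\<close> plays no role.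
\<close>

definition degenerate :: "'a measure \<Rightarrow> nat \<Rightarrow> ((nat \<Rightarrow> 'a) \<Rightarrow> real) set" where
  "degenerate \<nu> m = {\<phi> \<in> L2 (pow_measure \<nu> m).
     (AE y in pow_measure \<nu> m. (\<integral>\<xi>. \<phi> (y(1 := \<xi>)) \<partial>\<nu>) = 0) \<and>
     (AE y in pow_measure \<nu> m. (\<integral>\<xi>. \<phi> (y(m := \<xi>)) \<partial>\<nu>) = 0)}"

definition S_space :: "'a measure \<Rightarrow> nat \<Rightarrow> nat \<Rightarrow> ((nat \<Rightarrow> 'a) \<Rightarrow> real) set" where
  "S_space \<nu> k l = {f \<in> H_space \<nu> k. \<exists>\<phi>.
     (\<forall>j\<in>{1..l}. \<phi> j \<in> degenerate \<nu> (k - l + 1)) \<and>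
     (AE x in pow_measure \<nu> k.
        f x = (\<Sum>j=1..l. \<phi> j (\<lambda>i\<in>{1..k - l + 1}. x (i + j - 1))))}"

definition L0_space :: "'a measure \<Rightarrow> nat \<Rightarrow> nat \<Rightarrow> ((nat \<Rightarrow> 'a) \<Rightarrow> real) set" where
  "L0_space \<nu> k l = S_space \<nu> k l \<inter> ker_B \<nu> k"

text \<open>
  The marginals, and the functions \<open>g_fun\<close> built from them, take the whole family \<open>x\<close> as their
  argument, but \<open>marginal \<nu> k f l i\<close> and \<open>g_fun \<nu> k f l i\<close> only read the variables
  \<open>x i, \<dots>, x (i + k - l)\<close>.
\<close>

definition marginal ::
  "'a measure \<Rightarrow> nat \<Rightarrow> ((nat \<Rightarrow> 'a) \<Rightarrow> real) \<Rightarrow> nat \<Rightarrow> nat \<Rightarrow> (nat \<Rightarrow> 'a) \<Rightarrow> real" where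
  "marginal \<nu> k f l i = (\<lambda>x.
     \<integral>z. f (merge {i..i + k - l} ({1..k} - {i..i + k - l}) (x, z))
       \<partial>PiM ({1..k} - {i..i + k - l}) (\<lambda>_. \<nu>))"

definition g_fun ::
  "'a measure \<Rightarrow> nat \<Rightarrow> ((nat \<Rightarrow> 'a) \<Rightarrow> real) \<Rightarrow> nat \<Rightarrow> nat \<Rightarrow> (nat \<Rightarrow> 'a) \<Rightarrow> real" where
  "g_fun \<nu> k f l i = (\<lambda>x.
     if l = k then marginal \<nu> k f k i x
     else if l + 1 = k then
       marginal \<nu> k f (k - 1) i x - marginal \<nu> k f k i x - marginal \<nu> k f k (i + 1) x
     else
       marginal \<nu> k f l i x + marginal \<nu> k f (l + 2) (i + 1) x
         - marginal \<nu> k f (l + 1) i x - marginal \<nu> k f (l + 1) (i + 1) x)"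

definition s_fun ::
  "'a measure \<Rightarrow> nat \<Rightarrow> ((nat \<Rightarrow> 'a) \<Rightarrow> real) \<Rightarrow> nat \<Rightarrow> (nat \<Rightarrow> 'a) \<Rightarrow> real" where
  "s_fun \<nu> k f l = (\<lambda>x. \<Sum>i=1..l. g_fun \<nu> k f l i x)"

end

theory Submission
  imports Defs
begin

text \<open>
  The sum $s_1 + \cdots + s_k$ telescopes to $f$. Integrating a marginal over one of its variables
  gives the marginal over the remaining ones, so $g_\ell^{(i)}$ integrates to zero over each end
  point of its block, which is the degeneracy condition defining $\mathcal S_\ell$.

  For degenerate $\phi$ of $k - \ell + 1$ variables let $U_j\phi$ be $\phi$ placed on the $j$-th block.
  Then $P U_j\phi = U_{j+1}\phi$ for $j < \ell$ and $P U_\ell\phi = 0$, while $P^*$ moves the block in the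
  other direction; as all shifts by less than $k$ occur in $B_k$, this gives
  $B_k U_j\phi = U_1\phi + \cdots + U_\ell\phi$. Replacing all $\phi_j$ by their mean therefore splits
  $\sum_j U_j\phi_j$ into its $\mathcal L_\ell$ and $\ker B_k$ components. The adjoint is averaging
  over a new first variable, because a cyclic shift of $k + 1$ independent variables preserves their
  law; orthogonality is the self-adjointness of $B_k$.
\<close>

section \<open>Square integrable functions and averages over fibres\<close>

lemma L2D:
  assumes "f \<in> L2 M"
  shows "f \<in> borel_measurable M" "integrable M (\<lambda>x. (f x)\<^sup>2)"
  using assms by (auto simp: L2_def)

lemma L2_mult_integrable:
  assumes "f \<in> L2 M" "g \<in> L2 M"
  shows "integrable M (\<lambda>x. f x * g x)"
proof (rule Bochner_Integration.integrable_bound)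
  show "integrable M (\<lambda>x. (f x)\<^sup>2 + (g x)\<^sup>2)"
    using assms by (auto simp: L2_def)
  show "(\<lambda>x. f x * g x) \<in> borel_measurable M"
    using assms by (auto simp: L2_def)
  have "\<bar>a * b\<bar> \<le> a\<^sup>2 + b\<^sup>2" for a b :: real
    using sum_squares_bound[of "\<bar>a\<bar>" "\<bar>b\<bar>"] zero_le_power2[of a] zero_le_power2[of b]
    unfolding abs_mult power2_abs by linarith
  then show "AE x in M. norm (f x * g x) \<le> norm ((f x)\<^sup>2 + (g x)\<^sup>2)"
    by simp
qed

lemma L2_lincomb:
  assumes "f \<in> L2 M" "g \<in> L2 M"
  shows "(\<lambda>x. a * f x + b * g x) \<in> L2 M"
proof -
  have "integrable M (\<lambda>x. a\<^sup>2 * (f x)\<^sup>2 + 2 * a * b * (f x * g x) + b\<^sup>2 * (g x)\<^sup>2)"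
    using L2D[OF assms(1)] L2D[OF assms(2)] L2_mult_integrable[OF assms] by simp
  then have "integrable M (\<lambda>x. (a * f x + b * g x)\<^sup>2)"
    by (rule Bochner_Integration.integrable_cong[THEN iffD1, rotated -1])
       (auto simp: power2_eq_square algebra_simps)
  with assms show ?thesis
    by (auto simp: L2_def)
qed

lemma L2_zero: "(\<lambda>x. 0) \<in> L2 M"
  by (simp add: L2_def)

lemma (in prob_space) L2_integrable:
  assumes "f \<in> L2 M"
  shows "integrable M f"
  using square_integrable_imp_integrable L2D[OF assms] by blast

text \<open>The difference of the two sides is the variance of f.\<close>

lemma (in prob_space) square_integral_le:
  assumes "f \<in> L2 M"
  shows "(\<integral>x. f x \<partial>M)\<^sup>2 \<le> (\<integral>x. (f x)\<^sup>2 \<partial>M)"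
  using variance_positive[of f] variance_eq[OF L2_integrable[OF assms] L2D(2)[OF assms]] by simp

lemma (in prob_space) L2_AE_zero:
  assumes "f \<in> L2 M" "(\<integral>x. (f x)\<^sup>2 \<partial>M) = 0"
  shows "AE x in M. f x = 0"
  using integral_nonneg_eq_0_iff_AE[of M "\<lambda>x. (f x)\<^sup>2"] L2D[OF assms(1)] assms(2) by simp

section \<open>Change of variables along measure preserving maps\<close>

definition measure_pres :: "'b measure \<Rightarrow> 'c measure \<Rightarrow> ('b \<Rightarrow> 'c) \<Rightarrow> bool" where
  "measure_pres M N T \<longleftrightarrow> T \<in> measurable M N \<and> distr M N T = N"

lemma measure_pres_AE:
  assumes "measure_pres M N T" "AE y in N. P y"
  shows "AE x in M. P (T x)"
  using assms unfolding measure_pres_def by (metis AE_distrD)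

lemma measure_pres_L2:
  assumes T: "measure_pres M N T" and f: "f \<in> L2 N"
  shows "(\<lambda>x. f (T x)) \<in> L2 M"
proof -
  have "T \<in> measurable M N" and D: "distr M N T = N"
    using T by (auto simp: measure_pres_def)
  then show ?thesis
    using L2D[OF f] integrable_distr[of T M N "\<lambda>x. (f x)\<^sup>2"]
    by (auto simp: L2_def D)
qed

lemma measure_pres_integral:
  fixes f :: "'c \<Rightarrow> real"
  assumes T: "measure_pres M N T" and f: "f \<in> borel_measurable N"
  shows "(\<integral>x. f (T x) \<partial>M) = (\<integral>y. f y \<partial>N)"
  using T integral_distr[of T M N f] f by (auto simp: measure_pres_def)

lemma measure_pres_integrable:
  fixes f :: "'c \<Rightarrow> real"
  assumes T: "measure_pres M N T" and f: "integrable N f"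
  shows "integrable M (\<lambda>x. f (T x))"
  using T f by (metis integrable_distr measure_pres_def)

lemma measure_pres_comp:
  assumes "measure_pres M N T" "measure_pres N R S"
  shows "measure_pres M R (\<lambda>x. S (T x))"
proof -
  have "distr M R (S \<circ> T) = distr (distr M N T) R S"
    using assms by (intro distr_distr[symmetric]) (auto simp: measure_pres_def)
  then show ?thesis
    using assms measurable_comp[of T M N S R] by (auto simp: measure_pres_def comp_def)
qed

text \<open>Realises R as the image of a product law, so that \<open>avg f\<close> is the
  conditional expectation of f given the first factor. Averages over one fresh variable, the
  integrals behind the adjoint of P, and the marginals are all instances.\<close>

locale fibration = M: prob_space M + N: prob_space N
  for M :: "'b measure" and N :: "'c measure" +
  fixes R :: "'d measure" and T :: "'b \<times> 'c \<Rightarrow> 'd"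
  assumes pres: "measure_pres (M \<Otimes>\<^sub>M N) R T"
begin

sublocale MN: pair_prob_space M N ..

definition avg :: "('d \<Rightarrow> real) \<Rightarrow> 'b \<Rightarrow> real" where
  "avg f x = (\<integral>y. f (T (x, y)) \<partial>N)"

lemma measurable_T[measurable]: "T \<in> measurable (M \<Otimes>\<^sub>M N) R"
  using pres by (simp add: measure_pres_def)

lemma avg_measurable:
  assumes [measurable]: "f \<in> borel_measurable R"
  shows "avg f \<in> borel_measurable M"
  unfolding avg_def by measurable

lemma AE_fibre:
  assumes "AE z in R. Q z"
  shows "AE x in M. AE y in N. Q (T (x, y))"
  by (rule MN.AE_pair[OF measure_pres_AE[OF pres assms]])

lemma AE_fibre_L2:
  assumes f: "f \<in> L2 R"
  shows "AE x in M. (\<lambda>y. f (T (x, y))) \<in> L2 N"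
proof -
  have f'[measurable]: "f \<in> borel_measurable R" using L2D(1)[OF f] .
  have "AE x in M. integrable N (\<lambda>y. (f (T (x, y)))\<^sup>2)"
    using MN.AE_integrable_fst'[OF measure_pres_integrable[OF pres L2D(2)[OF f]]] .
  \<comment> \<open>Measurability of the fibre function is available for x in the space of M, which
    \<open>AE_space\<close> supplies.\<close>
  then show ?thesis
    using AE_space by eventually_elim (auto simp: L2_def)
qed

lemma integral_avg:
  assumes f: "integrable R f"
  shows "(\<integral>x. avg f x \<partial>M) = (\<integral>z. f z \<partial>R)"
proof -
  have f'[measurable]: "f \<in> borel_measurable R" using f by simp
  show ?thesis
    unfolding avg_def
    using MN.integral_fst'[OF measure_pres_integrable[OF pres f]]
      measure_pres_integral[OF pres f'] by simp
qed

text \<open>Jensen on each fibre bounds the squared average by the average of the square, which is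
  integrable by Fubini.\<close>

lemma avg_L2:
  assumes f: "f \<in> L2 R"
  shows "avg f \<in> L2 M"
proof -
  have [measurable]: "f \<in> borel_measurable R" using L2D(1)[OF f] .
  have "integrable M (\<lambda>x. (avg f x)\<^sup>2)"
  proof (rule Bochner_Integration.integrable_bound)
    show "integrable M (\<lambda>x. \<integral>y. (f (T (x, y)))\<^sup>2 \<partial>N)"
      using MN.integrable_fst'[OF measure_pres_integrable[OF pres L2D(2)[OF f]]] .
    show "(\<lambda>x. (avg f x)\<^sup>2) \<in> borel_measurable M"
      using avg_measurable[of f] by measurable
    show "AE x in M. norm ((avg f x)\<^sup>2) \<le> norm (\<integral>y. (f (T (x, y)))\<^sup>2 \<partial>N)"
      using AE_fibre_L2[OF f]
      by eventually_elim (auto simp: avg_def dest!: N.square_integral_le)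
  qed
  then show ?thesis
    using avg_measurable[of f] by (simp add: L2_def)
qed

text \<open>Linearity may fail on the null set of x whose fibre functions are not integrable,
  because the Bochner integral takes the default value 0 there.\<close>

lemma avg_lincomb:
  assumes "f \<in> L2 R" "g \<in> L2 R"
  shows "AE x in M. avg (\<lambda>z. a * f z + b * g z) x = a * avg f x + b * avg g x"
  using AE_fibre_L2[OF assms(1)] AE_fibre_L2[OF assms(2)]
  by eventually_elim (simp add: avg_def N.L2_integrable)

lemma avg_cong_AE:
  assumes f: "f \<in> L2 R" and g: "g \<in> L2 R" and eq: "AE z in R. f z = g z"
  shows "AE x in M. avg f x = avg g x"
  using AE_fibre_L2[OF f] AE_fibre_L2[OF g] AE_fibre[OF eq]
  by eventually_elim (auto simp: avg_def intro!: integral_cong_AE dest: L2D)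

end

section \<open>Averages over one coordinate of a product space\<close>

text \<open>Points of the product use the indices from 1 on, so index 0 is free to hold the
  integration variable; t tells which variable each argument of f reads. P, its adjoint and the
  integrals over an end point differ only in t.\<close>

definition cond_avg ::
  "'a measure \<Rightarrow> nat \<Rightarrow> (nat \<Rightarrow> nat) \<Rightarrow> ((nat \<Rightarrow> 'a) \<Rightarrow> real) \<Rightarrow> (nat \<Rightarrow> 'a) \<Rightarrow> real" where
  "cond_avg \<nu> m t f = (\<lambda>x. \<integral>\<xi>. f (\<lambda>i\<in>{1..m}. (x(0 := \<xi>)) (t i)) \<partial>\<nu>)"

context prob_space
begin

lemma PiM_prob: "prob_space (PiM I (\<lambda>_. M))"
  by (intro prob_space_PiM prob_space_axioms)

lemma pow_prob: "prob_space (pow_measure M n)"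
  unfolding pow_measure_def by (rule PiM_prob)

text \<open>Distinct coordinates, taken in any order from independent ones with common law, are
  again independent with that law.\<close>

lemma reindex_pres:
  assumes "inj_on t J" "t \<in> J \<rightarrow> I"
  shows "measure_pres (PiM I (\<lambda>_. M)) (PiM J (\<lambda>_. M)) (\<lambda>\<omega>. \<lambda>j\<in>J. \<omega> (t j))"
  unfolding measure_pres_def
proof
  show "(\<lambda>\<omega>. \<lambda>j\<in>J. \<omega> (t j)) \<in> measurable (PiM I (\<lambda>_. M)) (PiM J (\<lambda>_. M))"
    using assms by (intro measurable_restrict measurable_component_singleton) auto
  show "distr (PiM I (\<lambda>_. M)) (PiM J (\<lambda>_. M)) (\<lambda>\<omega>. \<lambda>j\<in>J. \<omega> (t j)) = PiM J (\<lambda>_. M)"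
    using distr_PiM_reindex[of I "\<lambda>_. M" t J] assms prob_space_axioms by simp
qed

lemma restrict_pres:
  assumes "J \<subseteq> I"
  shows "measure_pres (PiM I (\<lambda>_. M)) (PiM J (\<lambda>_. M)) (\<lambda>\<omega>. restrict \<omega> J)"
  using reindex_pres[of "\<lambda>j. j" J I] assms by (auto simp: inj_on_def)

lemma pow_reindex_pres:
  assumes "inj_on t {1..m}" "t \<in> {1..m} \<rightarrow> {1..n}"
  shows "measure_pres (pow_measure M n) (pow_measure M m) (\<lambda>\<omega>. \<lambda>j\<in>{1..m}. \<omega> (t j))"
  unfolding pow_measure_def by (rule reindex_pres[OF assms])

lemma insert_pres:
  "measure_pres (PiM I (\<lambda>_. M) \<Otimes>\<^sub>M M) (PiM (insert b I) (\<lambda>_. M)) (\<lambda>(x, \<xi>). x(b := \<xi>))"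
proof -
  have M: "prob_space M" by (rule prob_space_axioms)
  interpret I: prob_space "PiM I (\<lambda>_. M)" by (rule PiM_prob)
  interpret pair_prob_space "PiM I (\<lambda>_. M)" M ..
  \<comment> \<open>\<open>distr_pair_PiM_eq_PiM\<close> has the new coordinate in the first factor,
    while \<open>avg\<close> integrates over the second.\<close>
  have swap: "measure_pres (PiM I (\<lambda>_. M) \<Otimes>\<^sub>M M) (M \<Otimes>\<^sub>M PiM I (\<lambda>_. M)) (\<lambda>(x, y). (y, x))"
  proof -
    interpret Q: pair_sigma_finite M "PiM I (\<lambda>_. M)" ..
    show ?thesis
      unfolding measure_pres_def using Q.distr_pair_swap measurable_pair_swap' by metis
  qed
  have upd: "measure_pres (M \<Otimes>\<^sub>M PiM I (\<lambda>_. M)) (PiM (insert b I) (\<lambda>_. M)) (\<lambda>(x, X). X(b := x))"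
    unfolding measure_pres_def
  proof
    show "(\<lambda>(x, X). X(b := x)) \<in> measurable (M \<Otimes>\<^sub>M PiM I (\<lambda>_. M)) (PiM (insert b I) (\<lambda>_. M))"
      unfolding case_prod_beta by (rule measurable_fun_upd[of _ I]) auto
    show "distr (M \<Otimes>\<^sub>M PiM I (\<lambda>_. M)) (PiM (insert b I) (\<lambda>_. M)) (\<lambda>(x, X). X(b := x)) = PiM (insert b I) (\<lambda>_. M)"
      using M by (intro distr_pair_PiM_eq_PiM[of I "\<lambda>_. M" b]) auto
  qed
  from measure_pres_comp[OF swap upd] show ?thesis
    by (simp add: case_prod_beta')
qed

text \<open>The map first adjoins the fresh variable at index 0 (\<open>insert_pres\<close>) and
  then selects coordinates through t (\<open>reindex_pres\<close>).\<close>

lemma cond_avg_fibration: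
  assumes t: "inj_on t {1..m}" "t \<in> {1..m} \<rightarrow> {0..n}"
  shows "fibration (pow_measure M n) M (pow_measure M m) (\<lambda>(x, \<xi>). \<lambda>i\<in>{1..m}. (x(0 := \<xi>)) (t i))"
proof -
  interpret n: prob_space "pow_measure M n" by (rule pow_prob)
  have "insert 0 {1..n} = {0..n}" by auto
  then have "measure_pres (pow_measure M n \<Otimes>\<^sub>M M) (PiM {0..n} (\<lambda>_. M)) (\<lambda>(x, \<xi>). x(0 := \<xi>))"
    using insert_pres[of "{1..n}" 0] by (simp add: pow_measure_def)
  from measure_pres_comp[OF this reindex_pres[OF t]]
  show ?thesis
    by unfold_locales (simp add: case_prod_beta' pow_measure_def)
qed

lemma
  assumes t: "inj_on t {1..m}" "t \<in> {1..m} \<rightarrow> {0..n}"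
  shows cond_avg_L2: "f \<in> L2 (pow_measure M m) \<Longrightarrow> cond_avg M m t f \<in> L2 (pow_measure M n)"
    and cond_avg_integral: "f \<in> L2 (pow_measure M m) \<Longrightarrow>
      (\<integral>x. cond_avg M m t f x \<partial>pow_measure M n) = (\<integral>x. f x \<partial>pow_measure M m)"
    and cond_avg_lincomb: "\<lbrakk>f \<in> L2 (pow_measure M m); g \<in> L2 (pow_measure M m)\<rbrakk> \<Longrightarrow>
      AE x in pow_measure M n. cond_avg M m t (\<lambda>z. a * f z + b * g z) x
        = a * cond_avg M m t f x + b * cond_avg M m t g x"
    and cond_avg_cong_AE: "\<lbrakk>f \<in> L2 (pow_measure M m); g \<in> L2 (pow_measure M m);
      AE z in pow_measure M m. f z = g z\<rbrakk> \<Longrightarrow>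
      AE x in pow_measure M n. cond_avg M m t f x = cond_avg M m t g x"
proof -
  interpret fibration "pow_measure M n" M "pow_measure M m" "\<lambda>(x, \<xi>). \<lambda>i\<in>{1..m}. (x(0 := \<xi>)) (t i)"
    by (rule cond_avg_fibration[OF t])
  interpret m: prob_space "pow_measure M m" by (rule pow_prob)
  have eq: "avg f = cond_avg M m t f" for f
    by (rule ext) (simp only: avg_def cond_avg_def prod.case)
  show "f \<in> L2 (pow_measure M m) \<Longrightarrow> cond_avg M m t f \<in> L2 (pow_measure M n)"
    using avg_L2 unfolding eq .
  show "f \<in> L2 (pow_measure M m) \<Longrightarrow>
      (\<integral>x. cond_avg M m t f x \<partial>pow_measure M n) = (\<integral>x. f x \<partial>pow_measure M m)"
    using integral_avg[OF m.L2_integrable] unfolding eq .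
  show "\<lbrakk>f \<in> L2 (pow_measure M m); g \<in> L2 (pow_measure M m)\<rbrakk> \<Longrightarrow>
      AE x in pow_measure M n. cond_avg M m t (\<lambda>z. a * f z + b * g z) x
        = a * cond_avg M m t f x + b * cond_avg M m t g x"
    using avg_lincomb unfolding eq .
  show "\<lbrakk>f \<in> L2 (pow_measure M m); g \<in> L2 (pow_measure M m);
      AE z in pow_measure M m. f z = g z\<rbrakk> \<Longrightarrow>
      AE x in pow_measure M n. cond_avg M m t f x = cond_avg M m t g x"
    using avg_cong_AE unfolding eq .
qed

end

section \<open>Operators on the space of centred functions\<close>

locale window = prob_space \<nu> for \<nu> :: "'a measure" +
  fixes k :: nat
  assumes k_pos: "1 \<le> k"
begin

abbreviation "\<pi> \<equiv> pow_measure \<nu> k"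
abbreviation "H \<equiv> H_space \<nu> k"
abbreviation "inn \<equiv> L2_inner \<pi>"

sublocale pow: prob_space \<pi>
  by (rule pow_prob)

lemma H_D:
  assumes "f \<in> H"
  shows "f \<in> L2 \<pi>" "(\<integral>x. f x \<partial>\<pi>) = 0"
  using assms by (auto simp: H_space_def)

lemma H_lincomb:
  assumes "f \<in> H" "g \<in> H"
  shows "(\<lambda>x. a * f x + b * g x) \<in> H"
  using H_D[OF assms(1)] H_D[OF assms(2)]
  by (simp add: H_space_def L2_lincomb pow.L2_integrable)

lemma H_zero: "(\<lambda>x. 0) \<in> H"
  by (simp add: H_space_def L2_zero)

lemma H_add: "f \<in> H \<Longrightarrow> g \<in> H \<Longrightarrow> (\<lambda>x. f x + g x) \<in> H"
  using H_lincomb[of f g 1 1] by simp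

lemma H_scale: "f \<in> H \<Longrightarrow> (\<lambda>x. c * f x) \<in> H"
  using H_lincomb[of f f c 0] by simp

lemma H_sum: "(\<And>j. j \<in> J \<Longrightarrow> F j \<in> H) \<Longrightarrow> (\<lambda>x. \<Sum>j\<in>J. F j x) \<in> H"
  by (induction J rule: infinite_finite_induct) (auto simp: H_zero intro: H_add)

lemma inner_lincomb_left:
  assumes "f \<in> H" "g \<in> H" "h \<in> H"
  shows "inn (\<lambda>x. a * f x + b * g x) h = a * inn f h + b * inn g h"
proof -
  have "integrable \<pi> (\<lambda>x. f x * h x)" "integrable \<pi> (\<lambda>x. g x * h x)"
    using assms by (auto intro!: L2_mult_integrable dest: H_D)
  then show ?thesis
    by (simp add: L2_inner_def ring_distribs mult.assoc)
qed

lemma inner_commute: "inn f g = inn g f"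
  by (simp add: L2_inner_def mult.commute)

lemma inner_cong_AE:
  assumes "f \<in> H" "f' \<in> H" "h \<in> H" "AE x in \<pi>. f x = f' x"
  shows "inn f h = inn f' h"
  unfolding L2_inner_def
  using assms by (intro integral_cong_AE) (auto dest!: H_D(1) L2D(1))

text \<open>Testing with the difference f - g gives it norm zero. This makes the adjoint unique
  almost everywhere.\<close>

lemma inner_eq_imp_AE_eq:
  assumes f: "f \<in> H" and g: "g \<in> H" and eq: "\<And>h. h \<in> H \<Longrightarrow> inn f h = inn g h"
  shows "AE x in \<pi>. f x = g x"
proof -
  define d where "d = (\<lambda>x. 1 * f x + (-1) * g x)"
  have d: "d \<in> H" unfolding d_def by (rule H_lincomb[OF f g])
  have "inn d d = 0"
    using inner_lincomb_left[OF f g d, of 1 "-1", folded d_def] eq[OF d] by simp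
  then have "AE x in \<pi>. d x = 0"
    using pow.L2_AE_zero[OF H_D(1)[OF d]] by (simp add: L2_inner_def power2_eq_square)
  then show ?thesis
    by (simp add: d_def)
qed

text \<open>The maps on representatives that induce a linear operator on classes modulo almost
  everywhere equality. Linearity holds only almost everywhere because integrals have default values
  and the adjoint is an arbitrary choice of representatives.\<close>

definition H_op :: "(((nat \<Rightarrow> 'a) \<Rightarrow> real) \<Rightarrow> (nat \<Rightarrow> 'a) \<Rightarrow> real) \<Rightarrow> bool" where
  "H_op T \<longleftrightarrow> (\<forall>f\<in>H. T f \<in> H)
    \<and> (\<forall>f\<in>H. \<forall>g\<in>H. \<forall>a b. AE x in \<pi>. T (\<lambda>x. a * f x + b * g x) x = a * T f x + b * T g x)
    \<and> (\<forall>f\<in>H. \<forall>g\<in>H. (AE x in \<pi>. f x = g x) \<longrightarrow> (AE x in \<pi>. T f x = T g x))"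

lemma H_opD:
  assumes "H_op T"
  shows H_op_H: "f \<in> H \<Longrightarrow> T f \<in> H"
    and H_op_lincomb: "f \<in> H \<Longrightarrow> g \<in> H \<Longrightarrow>
      AE x in \<pi>. T (\<lambda>x. a * f x + b * g x) x = a * T f x + b * T g x"
    and H_op_cong: "f \<in> H \<Longrightarrow> g \<in> H \<Longrightarrow> AE x in \<pi>. f x = g x \<Longrightarrow> AE x in \<pi>. T f x = T g x"
  using assms by (auto simp: H_op_def)

lemma H_opI:
  assumes "\<And>f. f \<in> H \<Longrightarrow> T f \<in> H"
    and "\<And>f g a b. f \<in> H \<Longrightarrow> g \<in> H \<Longrightarrow>
      AE x in \<pi>. T (\<lambda>x. a * f x + b * g x) x = a * T f x + b * T g x"
    and "\<And>f g. f \<in> H \<Longrightarrow> g \<in> H \<Longrightarrow> AE x in \<pi>. f x = g x \<Longrightarrow> AE x in \<pi>. T f x = T g x"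
  shows "H_op T"
  using assms unfolding H_op_def by blast

lemma H_op_id: "H_op (\<lambda>f. f)"
  by (rule H_opI) auto

lemma H_op_comp:
  assumes S: "H_op S" and T: "H_op T"
  shows "H_op (\<lambda>f. S (T f))"
proof (rule H_opI)
  fix f g a b assume fg: "f \<in> H" "g \<in> H"
  have "AE x in \<pi>. S (T (\<lambda>x. a * f x + b * g x)) x = S (\<lambda>x. a * T f x + b * T g x) x"
    using fg by (intro H_op_cong[OF S] H_op_lincomb[OF T] H_op_H[OF T] H_lincomb)
  moreover have "AE x in \<pi>. S (\<lambda>x. a * T f x + b * T g x) x = a * S (T f) x + b * S (T g) x"
    using fg by (intro H_op_lincomb[OF S] H_op_H[OF T])
  ultimately show "AE x in \<pi>. S (T (\<lambda>x. a * f x + b * g x)) x = a * S (T f) x + b * S (T g) x"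
    by eventually_elim simp
next
  fix f g assume "f \<in> H" "g \<in> H" "AE x in \<pi>. f x = g x"
  then show "AE x in \<pi>. S (T f) x = S (T g) x"
    by (intro H_op_cong[OF S] H_op_cong[OF T] H_op_H[OF T])
qed (intro H_op_H[OF S] H_op_H[OF T])

lemma H_op_funpow: "H_op T \<Longrightarrow> H_op (T ^^ n)"
  by (induction n) (simp_all add: H_op_id id_def comp_def H_op_comp)

lemma H_op_add:
  assumes S: "H_op S" and T: "H_op T"
  shows "H_op (\<lambda>f x. S f x + T f x)"
proof (rule H_opI)
  fix f g a b assume "f \<in> H" "g \<in> H"
  from H_op_lincomb[OF S this, of a b] H_op_lincomb[OF T this, of a b]
  show "AE x in \<pi>. S (\<lambda>x. a * f x + b * g x) x + T (\<lambda>x. a * f x + b * g x) x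
      = a * (S f x + T f x) + b * (S g x + T g x)"
    by eventually_elim (simp add: algebra_simps)
next
  fix f g assume "f \<in> H" "g \<in> H" "AE x in \<pi>. f x = g x"
  from H_op_cong[OF S this] H_op_cong[OF T this]
  show "AE x in \<pi>. S f x + T f x = S g x + T g x"
    by eventually_elim simp
qed (auto intro: H_add H_op_H[OF S] H_op_H[OF T])

lemma H_op_sum: "(\<And>j. j \<in> J \<Longrightarrow> H_op (T j)) \<Longrightarrow> H_op (\<lambda>f x. \<Sum>j\<in>J. T j f x)"
proof (induction J rule: infinite_finite_induct)
  case (insert j J)
  then show ?case using H_op_add[of "T j" "\<lambda>f x. \<Sum>j\<in>J. T j f x"] by simp
qed (auto intro!: H_opI H_zero)

text \<open>Serves to pass from the explicit \<open>Q_op\<close> to the chosen adjoint, which is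
  known only up to null sets.\<close>

lemma H_op_cong_AE:
  assumes S: "H_op S" and T: "\<And>f. f \<in> H \<Longrightarrow> T f \<in> H"
    and eq: "\<And>f. f \<in> H \<Longrightarrow> AE x in \<pi>. T f x = S f x"
  shows "H_op T"
proof (rule H_opI)
  fix f g a b assume "f \<in> H" "g \<in> H"
  with H_op_lincomb[OF S this, of a b] eq[of f] eq[of g] eq[OF H_lincomb[of f g a b]]
  show "AE x in \<pi>. T (\<lambda>x. a * f x + b * g x) x = a * T f x + b * T g x"
    by auto
next
  fix f g assume "f \<in> H" "g \<in> H" "AE x in \<pi>. f x = g x"
  with H_op_cong[OF S this] eq[of f] eq[of g]
  show "AE x in \<pi>. T f x = T g x"
    by auto
qed (rule T)

lemma H_op_zero_AE:
  assumes T: "H_op T" and "f \<in> H" "AE x in \<pi>. f x = 0"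
  shows "AE x in \<pi>. T f x = 0"
proof -
  have "AE x in \<pi>. T (\<lambda>x. 0) x = 0"
    using H_op_lincomb[OF T H_zero H_zero, of 0 0] by simp
  with H_op_cong[OF T assms(2) H_zero assms(3)] show ?thesis
    by eventually_elim simp
qed

lemma H_op_sum_AE:
  assumes T: "H_op T" and F: "\<And>j. j \<in> J \<Longrightarrow> F j \<in> H"
  shows "AE x in \<pi>. T (\<lambda>x. \<Sum>j\<in>J. F j x) x = (\<Sum>j\<in>J. T (F j) x)"
  using F
proof (induction J rule: infinite_finite_induct)
  case (insert j J)
  then have "F j \<in> H" "(\<lambda>x. \<Sum>j\<in>J. F j x) \<in> H" by (auto intro: H_sum)
  from H_op_lincomb[OF T this, of 1 1] insert show ?case by auto
qed (use H_op_zero_AE[OF T H_zero] in auto)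

definition adjoint_pair where
  "adjoint_pair T T' \<longleftrightarrow> (\<forall>f\<in>H. \<forall>g\<in>H. inn (T f) g = inn f (T' g))"

lemma adjoint_pair_sym: "adjoint_pair T T' \<Longrightarrow> adjoint_pair T' T"
  unfolding adjoint_pair_def by (metis inner_commute)

lemma adjoint_pair_id: "adjoint_pair (\<lambda>f. f) (\<lambda>f. f)"
  by (simp add: adjoint_pair_def)

lemma adjoint_pair_funpow:
  assumes "adjoint_pair T T'" "H_op T" "H_op T'"
  shows "adjoint_pair (T ^^ n) (T' ^^ n)"
proof (induction n)
  case 0
  show ?case by (simp add: adjoint_pair_id id_def)
next
  case (Suc n)
  have "inn ((T ^^ Suc n) f) g = inn f ((T' ^^ Suc n) g)" if "f \<in> H" "g \<in> H" for f g
  proof -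
    have "inn ((T ^^ Suc n) f) g = inn ((T ^^ n) f) (T' g)"
      using assms that H_op_H[OF H_op_funpow[OF assms(2)]] by (simp add: adjoint_pair_def)
    also have "\<dots> = inn f ((T' ^^ n) (T' g))"
      using Suc that H_op_H[OF assms(3)] by (simp add: adjoint_pair_def)
    finally show ?thesis by (simp add: funpow_swap1)
  qed
  then show ?case by (simp add: adjoint_pair_def)
qed

lemma adjoint_pair_add:
  assumes "adjoint_pair S S'" "adjoint_pair T T'" "H_op S" "H_op T" "H_op S'" "H_op T'"
  shows "adjoint_pair (\<lambda>f x. S f x + T f x) (\<lambda>f x. S' f x + T' f x)"
  unfolding adjoint_pair_def
proof (intro ballI)
  fix f g assume fg: "f \<in> H" "g \<in> H"
  have "inn (\<lambda>x. S f x + T f x) g = inn (S f) g + inn (T f) g"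
    using inner_lincomb_left[of "S f" "T f" g 1 1] fg assms by (simp add: H_op_H)
  also have "\<dots> = inn f (S' g) + inn f (T' g)"
    using assms fg by (simp add: adjoint_pair_def)
  also have "\<dots> = inn f (\<lambda>x. S' g x + T' g x)"
    using inner_lincomb_left[of "S' g" "T' g" f 1 1] fg assms
    by (simp add: H_op_H inner_commute[of f])
  finally show "inn (\<lambda>x. S f x + T f x) g = inn f (\<lambda>x. S' g x + T' g x)" .
qed

lemma adjoint_pair_sum:
  assumes "\<And>j. j \<in> J \<Longrightarrow> adjoint_pair (T j) (T' j)"
    "\<And>j. j \<in> J \<Longrightarrow> H_op (T j)" "\<And>j. j \<in> J \<Longrightarrow> H_op (T' j)"
  shows "adjoint_pair (\<lambda>f x. \<Sum>j\<in>J. T j f x) (\<lambda>f x. \<Sum>j\<in>J. T' j f x)"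
  using assms
proof (induction J rule: infinite_finite_induct)
  case (insert j J)
  then have "adjoint_pair (\<lambda>f x. T j f x + (\<Sum>j\<in>J. T j f x)) (\<lambda>f x. T' j f x + (\<Sum>j\<in>J. T' j f x))"
    by (intro adjoint_pair_add H_op_sum) auto
  with insert show ?case by simp
qed (auto simp: adjoint_pair_def L2_inner_def)

end

section \<open>The shift operator P, its adjoint and the operator B_k\<close>

context window
begin

lemma cond_avg_H_op:
  assumes t: "inj_on t {1..k}" "t \<in> {1..k} \<rightarrow> {0..k}"
  shows "H_op (cond_avg \<nu> k t)"
proof (rule H_opI)
  show "cond_avg \<nu> k t f \<in> H" if "f \<in> H" for f
    using cond_avg_L2[OF t] cond_avg_integral[OF t] H_D[OF that] by (simp add: H_space_def)
  show "AE x in \<pi>. cond_avg \<nu> k t (\<lambda>x. a * f x + b * g x) x = a * cond_avg \<nu> k t f x + b * cond_avg \<nu> k t g x"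
    if "f \<in> H" "g \<in> H" for f g a b
    by (rule cond_avg_lincomb[OF t H_D(1)[OF that(1)] H_D(1)[OF that(2)]])
  show "AE x in \<pi>. cond_avg \<nu> k t f x = cond_avg \<nu> k t g x"
    if "f \<in> H" "g \<in> H" "AE x in \<pi>. f x = g x" for f g
    by (rule cond_avg_cong_AE[OF t H_D(1)[OF that(1)] H_D(1)[OF that(2)] that(3)])
qed

text \<open>On {0..k} this is the cyclic shift; on {1..k} it is the index map of P, whose last
  argument reads the fresh variable at 0.\<close>

definition fwd :: "nat \<Rightarrow> nat" where
  "fwd i = (if i < k then i + 1 else 0)"

text \<open>The explicit candidate for the adjoint of P: the first argument reads index 1 - 1 = 0,
  the fresh variable, and the others move up by one place.\<close>

definition Q_op :: "((nat \<Rightarrow> 'a) \<Rightarrow> real) \<Rightarrow> (nat \<Rightarrow> 'a) \<Rightarrow> real" where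
  "Q_op = cond_avg \<nu> k (\<lambda>i. i - 1)"

lemma P_op_eq: "P_op \<nu> k = cond_avg \<nu> k fwd"
proof (intro ext)
  fix f x
  have "(\<lambda>i\<in>{1..k}. if i < k then x (i + 1) else \<xi>) = (\<lambda>i\<in>{1..k}. (x(0 := \<xi>)) (fwd i))" for \<xi> :: 'a
    by (auto simp: fwd_def restrict_def)
  then show "P_op \<nu> k f x = cond_avg \<nu> k fwd f x"
    by (simp only: P_op_def cond_avg_def)
qed

lemma H_op_P: "H_op (P_op \<nu> k)"
  unfolding P_op_eq by (rule cond_avg_H_op) (auto simp: inj_on_def fwd_def split: if_splits)

lemma H_op_Q: "H_op Q_op"
  unfolding Q_op_def by (rule cond_avg_H_op) (auto simp: inj_on_def)

text \<open>With the fresh variable as w_0, both sides are integrals over w = (w_0, ..., w_k): the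
  left one of g(w_2, ..., w_k, w_0) f(w_1, ..., w_k), the right one of g(w_1, ..., w_k) f(w_0, ...,
  w_{k-1}).\<close>

lemma inner_P_Q:
  assumes g: "g \<in> H" and f: "f \<in> H"
  shows "inn (P_op \<nu> k g) f = inn g (Q_op f)"
proof -
  define W where "W = PiM {0..k} (\<lambda>_. \<nu>)"
  interpret fibration \<pi> \<nu> W "\<lambda>(x, \<xi>). x(0 := \<xi>)"
  proof unfold_locales
    have "insert 0 {1..k} = {0..k}" by auto
    then show "measure_pres (\<pi> \<Otimes>\<^sub>M \<nu>) W (\<lambda>(x, \<xi>). x(0 := \<xi>))"
      using insert_pres[of "{1..k}" 0] by (simp add: W_def pow_measure_def)
  qed
  define r where "r t w = (\<lambda>i\<in>{1..k}. w (t i))" for t :: "nat \<Rightarrow> nat" and w :: "nat \<Rightarrow> 'a"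
  have r: "measure_pres W \<pi> (r t)" if "inj_on t {1..k}" "t \<in> {1..k} \<rightarrow> {0..k}" for t
    using reindex_pres[OF that] by (simp add: W_def pow_measure_def r_def[abs_def])
  have r_fwd: "measure_pres W \<pi> (r fwd)" and r_id: "measure_pres W \<pi> (r (\<lambda>i. i))"
    and r_pred: "measure_pres W \<pi> (r (\<lambda>i. i - 1))"
    by (rule r; auto simp: inj_on_def fwd_def split: if_splits)+
  define G where "G w = g (r fwd w) * f (r (\<lambda>i. i) w)" for w
  define G' where "G' w = g (r (\<lambda>i. i) w) * f (r (\<lambda>i. i - 1) w)" for w
  have fL: "f \<in> L2 \<pi>" and gL: "g \<in> L2 \<pi>" using f g by (auto dest: H_D)
  have G: "integrable W G" and G': "integrable W G'"
    unfolding G_def[abs_def] G'_def[abs_def]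
    by (intro L2_mult_integrable measure_pres_L2[OF r_fwd] measure_pres_L2[OF r_id]
        measure_pres_L2[OF r_pred] fL gL)+
  \<comment> \<open>Index 0 is not among those read, and points of the space are extensional, so the
    restriction to {1..k} gives back x.\<close>
  have ext: "r (\<lambda>i. i) (x(0 := \<xi>)) = x" if "x \<in> space \<pi>" for x \<xi>
    using that by (auto simp: r_def pow_measure_def space_PiM PiE_def extensional_def fun_eq_iff)
  have "inn (P_op \<nu> k g) f = (\<integral>x. avg G x \<partial>\<pi>)"
    unfolding L2_inner_def P_op_eq avg_def cond_avg_def
    by (intro Bochner_Integration.integral_cong refl) (simp add: G_def ext, simp add: r_def)
  also have "\<dots> = (\<integral>w. G w \<partial>W)"
    by (rule integral_avg[OF G])
  also have "\<dots> = (\<integral>w. G' w \<partial>W)"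
  proof -
    \<comment> \<open>The cyclic shift of the k + 1 variables preserves their law and carries the
      second integrand to the first.\<close>
    define c where "c w = (\<lambda>i\<in>{0..k}. w (fwd i))" for w :: "nat \<Rightarrow> 'a"
    have "measure_pres W W c"
      unfolding W_def c_def[abs_def]
      by (rule reindex_pres) (auto simp: inj_on_def fwd_def split: if_splits)
    then have "(\<integral>w. G' (c w) \<partial>W) = (\<integral>w. G' w \<partial>W)"
      using G' by (intro measure_pres_integral) auto
    moreover have "G' (c w) = G w" for w
    proof -
      have "r (\<lambda>i. i) (c w) = r fwd w" "r (\<lambda>i. i - 1) (c w) = r (\<lambda>i. i) w"
        by (auto simp: r_def c_def fun_eq_iff fwd_def)
      then show ?thesis by (simp add: G_def G'_def)
    qed
    ultimately show ?thesis by simp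
  qed
  also have "\<dots> = (\<integral>x. avg G' x \<partial>\<pi>)"
    by (rule integral_avg[OF G', symmetric])
  also have "\<dots> = inn g (Q_op f)"
    unfolding L2_inner_def Q_op_def avg_def cond_avg_def
    by (intro Bochner_Integration.integral_cong refl) (simp add: G'_def ext, simp add: r_def)
  finally show ?thesis .
qed

text \<open>\<open>Q_op f\<close> witnesses existence, so the choice in \<open>P_adj\<close> does
  deliver an adjoint.\<close>

lemma P_adj_spec:
  assumes f: "f \<in> H"
  shows P_adj_H: "P_adj \<nu> k f \<in> H"
    and inner_P_adj: "g \<in> H \<Longrightarrow> inn (P_op \<nu> k g) f = inn g (P_adj \<nu> k f)"
proof -
  let ?R = "\<lambda>h. h \<in> H \<and> (\<forall>g\<in>H. inn (P_op \<nu> k g) f = inn g h)"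
  have "?R (Q_op f)"
    using inner_P_Q f H_op_H[OF H_op_Q f] by auto
  then have "?R (P_adj \<nu> k f)"
    unfolding P_adj_def by (rule someI[of ?R])
  then show "P_adj \<nu> k f \<in> H" "g \<in> H \<Longrightarrow> inn (P_op \<nu> k g) f = inn g (P_adj \<nu> k f)"
    by auto
qed

lemma P_adj_AE_eq:
  assumes f: "f \<in> H"
  shows "AE x in \<pi>. P_adj \<nu> k f x = Q_op f x"
  using P_adj_spec[OF f] inner_P_Q[OF _ f] H_op_H[OF H_op_Q f]
  by (intro inner_eq_imp_AE_eq) (auto simp: inner_commute[of _ "h" for h])

lemma H_op_P_adj: "H_op (P_adj \<nu> k)"
  by (rule H_op_cong_AE[OF H_op_Q P_adj_H P_adj_AE_eq])

lemma B_op_eq: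
  "B_op \<nu> k = (\<lambda>f x. f x + (\<Sum>j\<in>{1..<k}. (P_op \<nu> k ^^ j) f x + (P_adj \<nu> k ^^ j) f x))"
  by (simp add: B_op_def fun_eq_iff)

lemma H_op_B: "H_op (B_op \<nu> k)"
  unfolding B_op_eq
  by (intro H_op_add H_op_sum H_op_id H_op_funpow H_op_P H_op_P_adj)

text \<open>Passing to adjoints exchanges the two powers in each summand, and commutativity of
  addition restores the order.\<close>

lemma B_self_adjoint: "adjoint_pair (B_op \<nu> k) (B_op \<nu> k)"
proof -
  have P: "adjoint_pair (P_op \<nu> k ^^ j) (P_adj \<nu> k ^^ j)" for j
    by (intro adjoint_pair_funpow H_op_P H_op_P_adj) (auto simp: adjoint_pair_def inner_P_adj)
  have "adjoint_pair (\<lambda>f x. (P_op \<nu> k ^^ j) f x + (P_adj \<nu> k ^^ j) f x)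
      (\<lambda>f x. (P_op \<nu> k ^^ j) f x + (P_adj \<nu> k ^^ j) f x)" for j
    using adjoint_pair_add[OF P adjoint_pair_sym[OF P], of j j] H_op_funpow H_op_P H_op_P_adj
    by (simp add: add.commute)
  then show ?thesis
    unfolding B_op_eq
    by (intro adjoint_pair_add[OF adjoint_pair_id adjoint_pair_sum] H_op_add H_op_sum H_op_id
        H_op_funpow H_op_P H_op_P_adj)
qed

text \<open>Moving B_k across the inner product turns the factor a into b. Arbitrary real a and b
  let the kernel enter as the eigenvalue 0.\<close>

lemma eigenfunctions_orthogonal:
  assumes f: "f \<in> H" "AE x in \<pi>. B_op \<nu> k f x = a * f x"
    and g: "g \<in> H" "AE x in \<pi>. B_op \<nu> k g x = b * g x"
    and ab: "a \<noteq> b"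
  shows "inn f g = 0"
proof -
  note B = H_op_H[OF H_op_B]
  have "a * inn f g = inn (\<lambda>x. a * f x) g"
    using inner_lincomb_left[OF f(1) f(1) g(1), of a 0] by simp
  also have "\<dots> = inn (B_op \<nu> k f) g"
    using f g by (intro inner_cong_AE B H_scale) auto
  also have "\<dots> = inn f (B_op \<nu> k g)"
    using B_self_adjoint f(1) g(1) by (simp add: adjoint_pair_def)
  also have "\<dots> = inn (B_op \<nu> k g) f" by (rule inner_commute)
  also have "\<dots> = inn (\<lambda>x. b * g x) f"
    using f g by (intro inner_cong_AE B H_scale) auto
  also have "\<dots> = b * inn f g"
    using inner_lincomb_left[OF g(1) g(1) f(1), of b 0] by (simp add: inner_commute)
  finally show ?thesis using ab by simp
qed

end

section \<open>Degenerate functions placed on blocks of consecutive variables\<close>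

text \<open>Overwriting an end point amounts to letting that argument read index 0, which makes the
  general facts on \<open>cond_avg\<close> applicable.\<close>

lemma (in prob_space) degenerate_iff:
  assumes "1 \<le> m"
  shows "\<phi> \<in> degenerate M m \<longleftrightarrow> \<phi> \<in> L2 (pow_measure M m)
    \<and> (AE y in pow_measure M m. cond_avg M m (\<lambda>i. if i = 1 then 0 else i) \<phi> y = 0)
    \<and> (AE y in pow_measure M m. cond_avg M m (\<lambda>i. if i = m then 0 else i) \<phi> y = 0)"
proof -
  have eq: "y(b := \<xi>) = (\<lambda>i\<in>{1..m}. (y(0 := \<xi>)) (if i = b then 0 else i))"
    if "y \<in> space (pow_measure M m)" "b \<in> {1..m}" for y b \<xi>
    using that by (auto simp: pow_measure_def space_PiM PiE_def extensional_def fun_eq_iff)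
  have "(AE y in pow_measure M m. (\<integral>\<xi>. \<phi> (y(b := \<xi>)) \<partial>M) = 0) \<longleftrightarrow>
      (AE y in pow_measure M m. cond_avg M m (\<lambda>i. if i = b then 0 else i) \<phi> y = 0)"
    if "b \<in> {1..m}" for b
    by (rule AE_cong) (simp only: cond_avg_def eq[OF _ that])
  from this[of 1] this[of m] show ?thesis
    using assms by (auto simp: degenerate_def)
qed

lemma (in prob_space) degenerate_lincomb:
  assumes m: "1 \<le> m" and "\<phi> \<in> degenerate M m" "\<psi> \<in> degenerate M m"
  shows "(\<lambda>y. a * \<phi> y + b * \<psi> y) \<in> degenerate M m"
proof -
  have *: "AE y in pow_measure M m. cond_avg M m t (\<lambda>y. a * \<phi> y + b * \<psi> y) y = 0"
    if "inj_on t {1..m}" "t \<in> {1..m} \<rightarrow> {0..m}"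
      "AE y in pow_measure M m. cond_avg M m t \<phi> y = 0" "AE y in pow_measure M m. cond_avg M m t \<psi> y = 0" for t
    using cond_avg_lincomb[OF that(1,2), of \<phi> \<psi> a b] that(3,4) assms(2,3)
    unfolding degenerate_iff[OF m] by auto
  show ?thesis
    using assms(2,3) unfolding degenerate_iff[OF m]
    by (intro conjI L2_lincomb *) (auto simp: inj_on_def split: if_splits)
qed

lemma (in prob_space) degenerate_sum:
  assumes m: "1 \<le> m"
  shows "(\<And>j. j \<in> J \<Longrightarrow> \<phi> j \<in> degenerate M m) \<Longrightarrow> (\<lambda>y. \<Sum>j\<in>J. \<phi> j y) \<in> degenerate M m"
proof (induction J rule: infinite_finite_induct)
  case (insert j J)
  then show ?case using degenerate_lincomb[OF m, of "\<phi> j" "\<lambda>y. \<Sum>j\<in>J. \<phi> j y" 1 1] by simp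
qed (auto simp: degenerate_def L2_zero)

text \<open>Each i in {1..l} other than j is reached from j by exactly one shift to the right or
  left, and its length is below k because l \<le> k.\<close>

lemma sum_shifts:
  fixes u :: "nat \<Rightarrow> real"
  assumes "1 \<le> j" "j \<le> l" "l \<le> k"
  shows "u j + (\<Sum>n\<in>{1..<k}. (if j + n \<le> l then u (j + n) else 0) + (if n < j then u (j - n) else 0))
    = (\<Sum>i=1..l. u i)"
proof -
  have "(\<Sum>n\<in>{1..<k}. if j + n \<le> l then u (j + n) else 0) = (\<Sum>n | n \<in> {1..<k} \<and> j + n \<le> l. u (j + n))"
    by (rule sum.inter_filter[symmetric]) simp
  also have "\<dots> = (\<Sum>i\<in>{j<..l}. u i)"
    using assms by (intro sum.reindex_bij_witness[where i = "\<lambda>i. i - j" and j = "\<lambda>n. j + n"]) auto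
  finally have 1: "(\<Sum>n\<in>{1..<k}. if j + n \<le> l then u (j + n) else 0) = (\<Sum>i\<in>{j<..l}. u i)" .
  have "(\<Sum>n\<in>{1..<k}. if n < j then u (j - n) else 0) = (\<Sum>n | n \<in> {1..<k} \<and> n < j. u (j - n))"
    by (rule sum.inter_filter[symmetric]) simp
  also have "\<dots> = (\<Sum>i\<in>{1..<j}. u i)"
    using assms by (intro sum.reindex_bij_witness[where i = "\<lambda>i. j - i" and j = "\<lambda>n. j - n"]) auto
  finally have 2: "(\<Sum>n\<in>{1..<k}. if n < j then u (j - n) else 0) = (\<Sum>i\<in>{1..<j}. u i)" .
  have "{1..l} = insert j ({1..<j} \<union> {j<..l})" using assms by auto
  then have "(\<Sum>i=1..l. u i) = u j + ((\<Sum>i\<in>{1..<j}. u i) + (\<Sum>i\<in>{j<..l}. u i))"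
    by (simp only:) (subst sum.insert; (subst sum.union_disjoint)?; auto)
  then show ?thesis
    unfolding sum.distrib 1 2 by linarith
qed

text \<open>The U_j of the opening comment; the block consists of x_j, ..., x_{j+m-1}.\<close>

definition block_fun :: "nat \<Rightarrow> nat \<Rightarrow> ((nat \<Rightarrow> 'a) \<Rightarrow> real) \<Rightarrow> (nat \<Rightarrow> 'a) \<Rightarrow> real" where
  "block_fun m j \<phi> = (\<lambda>x. \<phi> (\<lambda>i\<in>{1..m}. x (i + j - 1)))"

section \<open>The action of P, its adjoint and B_k on degenerate functions of a block\<close>

context window
begin

text \<open>The orbit is prescribed only almost everywhere, so each further application of T relies
  on T respecting almost everywhere equality.\<close>

lemma funpow_orbit_AE:
  assumes T: "H_op T" and V: "\<And>n. V n \<in> H" and step: "\<And>n. AE x in \<pi>. T (V n) x = V (Suc n) x"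
  shows "AE x in \<pi>. (T ^^ n) (V 0) x = V n x"
proof (induction n)
  case (Suc n)
  have "AE x in \<pi>. T ((T ^^ n) (V 0)) x = T (V n) x"
    using Suc by (intro H_op_cong[OF T] H_op_H[OF H_op_funpow[OF T]] V)
  with step[of n] show ?case by auto
qed simp

context
  fixes l m :: nat
  assumes l: "1 \<le> l" "l \<le> k" and m: "m = k - l + 1"
begin

lemma m_pos: "1 \<le> m"
  using m by simp

lemma block_fun_H:
  assumes \<phi>: "\<phi> \<in> degenerate \<nu> m" and j: "j \<in> {1..l}"
  shows "block_fun m j \<phi> \<in> H"
proof -
  have pres: "measure_pres \<pi> (pow_measure \<nu> m) (\<lambda>x. \<lambda>i\<in>{1..m}. x (i + j - 1))"
    using j l m by (intro pow_reindex_pres) (auto simp: inj_on_def)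
  have L2: "\<phi> \<in> L2 (pow_measure \<nu> m)"
    and ae: "AE y in pow_measure \<nu> m. cond_avg \<nu> m (\<lambda>i. if i = 1 then 0 else i) \<phi> y = 0"
    using \<phi> unfolding degenerate_iff[OF m_pos] by auto
  have "(\<integral>x. block_fun m j \<phi> x \<partial>\<pi>) = (\<integral>y. \<phi> y \<partial>pow_measure \<nu> m)"
    unfolding block_fun_def by (rule measure_pres_integral[OF pres L2D(1)[OF L2]])
  \<comment> \<open>Integrating out the first variable alone already gives zero, by
    degeneracy.\<close>
  also have "\<dots> = (\<integral>y. cond_avg \<nu> m (\<lambda>i. if i = 1 then 0 else i) \<phi> y \<partial>pow_measure \<nu> m)"
    by (rule cond_avg_integral[OF _ _ L2, symmetric]) (auto simp: inj_on_def split: if_splits)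
  also have "\<dots> = 0"
    by (rule integral_eq_zero_AE[OF ae])
  finally show ?thesis
    using measure_pres_L2[OF pres L2] by (simp add: H_space_def block_fun_def)
qed

text \<open>Block j ends at j + m - 1, which is below k because j < l. The fresh variable is
  therefore not read, and the integral is that of a constant.\<close>

lemma P_block_fun:
  assumes j: "1 \<le> j" "j < l"
  shows "P_op \<nu> k (block_fun m j \<phi>) = block_fun m (Suc j) \<phi>"
proof
  fix x :: "nat \<Rightarrow> 'a"
  have "(\<lambda>i\<in>{1..m}. (\<lambda>i\<in>{1..k}. if i < k then x (i + 1) else \<xi>) (i + j - 1))
      = (\<lambda>i\<in>{1..m}. x (i + Suc j - 1))" for \<xi>
    using j l m by (auto simp: fun_eq_iff)
  then show "P_op \<nu> k (block_fun m j \<phi>) x = block_fun m (Suc j) \<phi> x"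
    by (simp only: P_op_def block_fun_def) (simp add: prob_space)
qed

lemma P_block_fun_last:
  assumes \<phi>: "\<phi> \<in> degenerate \<nu> m"
  shows "AE x in \<pi>. P_op \<nu> k (block_fun m l \<phi>) x = 0"
proof -
  \<comment> \<open>Argument m is overwritten by \<xi>. Its value 1 lies outside l + 1, ..., k,
    where the other arguments go, so the map stays injective.\<close>
  let ?s = "\<lambda>i. if i = m then 1 else i + l"
  have eq: "(\<lambda>i\<in>{1..m}. (\<lambda>i\<in>{1..k}. if i < k then x (i + 1) else \<xi>) (i + l - 1))
      = (\<lambda>i\<in>{1..m}. x (?s i))(m := \<xi>)" for x :: "nat \<Rightarrow> 'a" and \<xi>
    using l m by (auto simp: fun_eq_iff)
  have "measure_pres \<pi> (pow_measure \<nu> m) (\<lambda>x. \<lambda>i\<in>{1..m}. x (?s i))"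
    using l m by (intro pow_reindex_pres) (auto simp: inj_on_def)
  moreover have "AE y in pow_measure \<nu> m. (\<integral>\<xi>. \<phi> (y(m := \<xi>)) \<partial>\<nu>) = 0"
    using \<phi> by (simp add: degenerate_def)
  ultimately have "AE x in \<pi>. (\<integral>\<xi>. \<phi> ((\<lambda>i\<in>{1..m}. x (?s i))(m := \<xi>)) \<partial>\<nu>) = 0"
    by (rule measure_pres_AE)
  then show ?thesis
    by (simp only: P_op_def block_fun_def eq)
qed

text \<open>For j > 1 the block does not contain the first variable, so again the fresh variable is
  not read.\<close>

lemma Q_block_fun:
  assumes j: "1 < j" "j \<le> l"
  shows "Q_op (block_fun m j \<phi>) = block_fun m (j - 1) \<phi>"
proof
  fix x :: "nat \<Rightarrow> 'a"
  have "(\<lambda>i\<in>{1..m}. (\<lambda>i\<in>{1..k}. (x(0 := \<xi>)) (i - 1)) (i + j - 1))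
      = (\<lambda>i\<in>{1..m}. x (i + (j - 1) - 1))" for \<xi>
    using j l m by (auto simp: fun_eq_iff)
  then show "Q_op (block_fun m j \<phi>) x = block_fun m (j - 1) \<phi> x"
    by (simp only: Q_op_def cond_avg_def block_fun_def) (simp add: prob_space)
qed

lemma Q_block_fun_first:
  assumes \<phi>: "\<phi> \<in> degenerate \<nu> m"
  shows "AE x in \<pi>. Q_op (block_fun m 1 \<phi>) x = 0"
proof -
  \<comment> \<open>Argument 1 is overwritten by \<xi>. Its value k lies outside 1, ..., k - l,
    where the other arguments go, so the map stays injective.\<close>
  let ?s = "\<lambda>i. if i = 1 then k else i - 1"
  have eq: "(\<lambda>i\<in>{1..m}. (\<lambda>i\<in>{1..k}. (x(0 := \<xi>)) (i - 1)) (i + 1 - 1))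
      = (\<lambda>i\<in>{1..m}. x (?s i))(1 := \<xi>)" for x :: "nat \<Rightarrow> 'a" and \<xi>
    using l m by (auto simp: fun_eq_iff)
  have "measure_pres \<pi> (pow_measure \<nu> m) (\<lambda>x. \<lambda>i\<in>{1..m}. x (?s i))"
    using l m by (intro pow_reindex_pres) (auto simp: inj_on_def)
  moreover have "AE y in pow_measure \<nu> m. (\<integral>\<xi>. \<phi> (y(1 := \<xi>)) \<partial>\<nu>) = 0"
    using \<phi> by (simp add: degenerate_def)
  ultimately have "AE x in \<pi>. (\<integral>\<xi>. \<phi> ((\<lambda>i\<in>{1..m}. x (?s i))(1 := \<xi>)) \<partial>\<nu>) = 0"
    by (rule measure_pres_AE)
  then show ?thesis
    by (simp only: Q_op_def cond_avg_def block_fun_def eq)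
qed

lemma P_funpow_block_fun:
  assumes \<phi>: "\<phi> \<in> degenerate \<nu> m" and j: "j \<in> {1..l}"
  shows "AE x in \<pi>. (P_op \<nu> k ^^ n) (block_fun m j \<phi>) x
    = (if j + n \<le> l then block_fun m (j + n) \<phi> x else 0)"
proof -
  \<comment> \<open>The orbit of the block under P: it moves right one place at a time and is 0 once
    it would pass k.\<close>
  define V where "V n = (if j + n \<le> l then block_fun m (j + n) \<phi> else (\<lambda>x. 0))" for n
  have V: "V n \<in> H" for n
    using block_fun_H[OF \<phi>, of "j + n"] j by (simp add: V_def H_zero)
  have "AE x in \<pi>. P_op \<nu> k (V n) x = V (Suc n) x" for n
  proof -
    consider "j + n < l" | "j + n = l" | "l < j + n" by linarith
    then show ?thesis
    proof cases
      case 1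
      then show ?thesis using P_block_fun[of "j + n" \<phi>] j by (simp add: V_def)
    next
      case 2
      then show ?thesis using P_block_fun_last[OF \<phi>] by (simp add: V_def)
    next
      case 3
      then show ?thesis using H_op_zero_AE[OF H_op_P H_zero] by (simp add: V_def)
    qed
  qed
  from funpow_orbit_AE[of "P_op \<nu> k" V n, OF H_op_P V this] show ?thesis
    using j by (auto simp: V_def)
qed

lemma P_adj_funpow_block_fun:
  assumes \<phi>: "\<phi> \<in> degenerate \<nu> m" and j: "j \<in> {1..l}"
  shows "AE x in \<pi>. (P_adj \<nu> k ^^ n) (block_fun m j \<phi>) x
    = (if n < j then block_fun m (j - n) \<phi> x else 0)"
proof -
  \<comment> \<open>The mirror image: the block moves left and is 0 once it would pass 1. The steps
    are computed for \<open>Q_op\<close>, then transferred to the adjoint.\<close>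
  define V where "V n = (if n < j then block_fun m (j - n) \<phi> else (\<lambda>x. 0))" for n
  have V: "V n \<in> H" for n
    using block_fun_H[OF \<phi>, of "j - n"] j by (auto simp: V_def H_zero Suc_le_eq)
  have Q: "AE x in \<pi>. Q_op (V n) x = V (Suc n) x" for n
  proof -
    consider "Suc n < j" | "Suc n = j" | "j \<le> n" by linarith
    then show ?thesis
    proof cases
      case 1
      then show ?thesis using Q_block_fun[of "j - n" \<phi>] j by (simp add: V_def)
    next
      case 2
      then have "j - n = 1" by simp
      with 2 show ?thesis using Q_block_fun_first[OF \<phi>] by (simp add: V_def)
    next
      case 3
      then show ?thesis using H_op_zero_AE[OF H_op_Q H_zero] by (simp add: V_def)
    qed
  qed
  have "AE x in \<pi>. P_adj \<nu> k (V n) x = V (Suc n) x" for n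
    using Q[of n] P_adj_AE_eq[OF V, of n] by auto
  from funpow_orbit_AE[of "P_adj \<nu> k" V n, OF H_op_P_adj V this] show ?thesis
    using j by (auto simp: V_def)
qed

text \<open>The shifts occurring in B_k carry block j once to every block. The result is the same
  for all j, so B_k depends on a family \<phi>_j only through its sum.\<close>

lemma B_block_fun:
  assumes \<phi>: "\<phi> \<in> degenerate \<nu> m" and j: "j \<in> {1..l}"
  shows "AE x in \<pi>. B_op \<nu> k (block_fun m j \<phi>) x = (\<Sum>i=1..l. block_fun m i \<phi> x)"
proof -
  have "AE x in \<pi>. \<forall>n\<in>{1..<k}. (P_op \<nu> k ^^ n) (block_fun m j \<phi>) x
      = (if j + n \<le> l then block_fun m (j + n) \<phi> x else 0)"
    by (rule AE_finite_allI) (simp, rule P_funpow_block_fun[OF \<phi> j])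
  moreover have "AE x in \<pi>. \<forall>n\<in>{1..<k}. (P_adj \<nu> k ^^ n) (block_fun m j \<phi>) x
      = (if n < j then block_fun m (j - n) \<phi> x else 0)"
    by (rule AE_finite_allI) (simp, rule P_adj_funpow_block_fun[OF \<phi> j])
  ultimately show ?thesis
  proof eventually_elim
    case (elim x)
    have "B_op \<nu> k (block_fun m j \<phi>) x = block_fun m j \<phi> x + (\<Sum>n\<in>{1..<k}.
        (if j + n \<le> l then block_fun m (j + n) \<phi> x else 0)
        + (if n < j then block_fun m (j - n) \<phi> x else 0))"
      unfolding B_op_def using elim by (intro arg_cong2[where f = "(+)"] sum.cong refl) simp_all
    also have "\<dots> = (\<Sum>i=1..l. block_fun m i \<phi> x)"
      using j l by (intro sum_shifts) auto
    finally show ?case .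
  qed
qed

lemma B_sum_block_fun:
  assumes \<phi>: "\<And>j. j \<in> {1..l} \<Longrightarrow> \<phi> j \<in> degenerate \<nu> m"
  shows "AE x in \<pi>. B_op \<nu> k (\<lambda>x. \<Sum>j=1..l. block_fun m j (\<phi> j) x) x
    = (\<Sum>i=1..l. \<Sum>j=1..l. block_fun m i (\<phi> j) x)"
proof -
  have "AE x in \<pi>. B_op \<nu> k (\<lambda>x. \<Sum>j=1..l. block_fun m j (\<phi> j) x) x
      = (\<Sum>j=1..l. B_op \<nu> k (block_fun m j (\<phi> j)) x)"
    by (rule H_op_sum_AE[OF H_op_B]) (intro block_fun_H \<phi>)
  moreover have "AE x in \<pi>. \<forall>j\<in>{1..l}. B_op \<nu> k (block_fun m j (\<phi> j)) x
      = (\<Sum>i=1..l. block_fun m i (\<phi> j) x)"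
    by (rule AE_finite_allI) (simp, rule B_block_fun[OF \<phi>])
  ultimately show ?thesis
    by eventually_elim (simp, rule sum.swap)
qed

lemma S_space_iff:
  "s \<in> S_space \<nu> k l \<longleftrightarrow> s \<in> H \<and> (\<exists>\<phi>. (\<forall>j\<in>{1..l}. \<phi> j \<in> degenerate \<nu> m) \<and>
    (AE x in \<pi>. s x = (\<Sum>j=1..l. block_fun m j (\<phi> j) x)))"
  by (simp add: S_space_def block_fun_def m)

lemma S_space_decomp:
  assumes s: "s \<in> S_space \<nu> k l"
  shows "\<exists>u\<in>L_space \<nu> k l. \<exists>v\<in>L0_space \<nu> k l. AE x in \<pi>. s x = u x + v x"
proof -
  from s obtain \<phi> where \<phi>: "\<And>j. j \<in> {1..l} \<Longrightarrow> \<phi> j \<in> degenerate \<nu> m"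
    and s_eq: "AE x in \<pi>. s x = (\<Sum>j=1..l. block_fun m j (\<phi> j) x)"
    unfolding S_space_iff by blast
  \<comment> \<open>The mean of the family: by \<open>B_sum_block_fun\<close> the constant family
    \<Phi> yields the factor l, while the deviations \<psi>_j sum to zero and are
    annihilated.\<close>
  define \<Phi> where "\<Phi> = (\<lambda>y. (1 / real l) * (\<Sum>j=1..l. \<phi> j y))"
  define \<psi> where "\<psi> j = (\<lambda>y. \<phi> j y - \<Phi> y)" for j
  have sum: "(\<lambda>y. \<Sum>j=1..l. \<phi> j y) \<in> degenerate \<nu> m"
    by (rule degenerate_sum[OF m_pos \<phi>])
  have \<Phi>: "\<Phi> \<in> degenerate \<nu> m"
    using degenerate_lincomb[OF m_pos sum sum, of "1 / real l" 0] by (simp add: \<Phi>_def)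
  have \<psi>: "\<psi> j \<in> degenerate \<nu> m" if "j \<in> {1..l}" for j
    using degenerate_lincomb[OF m_pos \<phi>[OF that] \<Phi>, of 1 "-1"] by (simp add: \<psi>_def)
  define u where "u = (\<lambda>x. \<Sum>j=1..l. block_fun m j \<Phi> x)"
  define v where "v = (\<lambda>x. \<Sum>j=1..l. block_fun m j (\<psi> j) x)"
  have uH: "u \<in> H" unfolding u_def by (intro H_sum block_fun_H \<Phi>)
  have vH: "v \<in> H" unfolding v_def by (intro H_sum block_fun_H \<psi>)
  have "AE x in \<pi>. B_op \<nu> k u x = real l * u x"
    using B_sum_block_fun[of "\<lambda>_. \<Phi>"] \<Phi> by (simp add: u_def sum_distrib_left)
  with uH have "u \<in> L_space \<nu> k l" by (simp add: L_space_def)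
  moreover have "(\<Sum>j=1..l. \<psi> j y) = 0" for y
    using l by (simp add: \<psi>_def \<Phi>_def sum_subtractf)
  then have "(\<Sum>j=1..l. block_fun m i (\<psi> j) x) = 0" for i x
    by (simp only: block_fun_def)
  then have "AE x in \<pi>. B_op \<nu> k v x = 0"
    using B_sum_block_fun[of \<psi>, OF \<psi>] by (simp add: v_def)
  with vH have "v \<in> ker_B \<nu> k" by (simp add: ker_B_def)
  moreover have "v \<in> S_space \<nu> k l"
    unfolding S_space_iff using vH \<psi> by (intro conjI exI[of _ \<psi>]) (auto simp: v_def)
  moreover have "AE x in \<pi>. s x = u x + v x"
    using s_eq by eventually_elim (simp add: u_def v_def \<psi>_def block_fun_def sum_subtractf)
  ultimately show ?thesis
    unfolding L0_space_def by blast
qed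

end

text \<open>There is only one block when l = 1, so B_k acts as the identity. Applied to the kernel
  component of s_1, this forces that component to vanish.\<close>

lemma S_space_1:
  assumes s: "s \<in> S_space \<nu> k 1"
  shows "AE x in \<pi>. B_op \<nu> k s x = s x"
proof -
  have *: "1 \<le> (1::nat)" "1 \<le> k" "k = k - 1 + 1" using k_pos by auto
  from s obtain \<phi> where sH: "s \<in> H" and \<phi>: "\<phi> 1 \<in> degenerate \<nu> k"
    and s_eq: "AE x in \<pi>. s x = block_fun k 1 (\<phi> 1) x"
    unfolding S_space_iff[OF *] by auto
  have "AE x in \<pi>. B_op \<nu> k s x = B_op \<nu> k (block_fun k 1 (\<phi> 1)) x"
    by (rule H_op_cong[OF H_op_B sH block_fun_H[OF * \<phi>] s_eq]) simp
  moreover have "AE x in \<pi>. B_op \<nu> k (block_fun k 1 (\<phi> 1)) x = block_fun k 1 (\<phi> 1) x"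
    using B_block_fun[OF * \<phi>, of 1] by simp
  ultimately show ?thesis
    using s_eq by eventually_elim simp
qed

end

section \<open>Marginals\<close>

text \<open>Indexed by an arbitrary set A instead of a block, so that dropping end points is a set
  difference and may lead to the empty set.\<close>

definition marg ::
  "'a measure \<Rightarrow> nat \<Rightarrow> nat set \<Rightarrow> ((nat \<Rightarrow> 'a) \<Rightarrow> real) \<Rightarrow> (nat \<Rightarrow> 'a) \<Rightarrow> real" where
  "marg \<nu> k A f = (\<lambda>x. \<integral>z. f (merge A ({1..k} - A) (x, z)) \<partial>PiM ({1..k} - A) (\<lambda>_. \<nu>))"

lemma marginal_eq_marg: "marginal \<nu> k f l i = marg \<nu> k {i..i + k - l} f"
  by (simp add: marginal_def marg_def)

lemma marg_cong: "(\<And>i. i \<in> A \<Longrightarrow> x i = y i) \<Longrightarrow> marg \<nu> k A f x = marg \<nu> k A f y"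
proof -
  assume "\<And>i. i \<in> A \<Longrightarrow> x i = y i"
  then have "merge A B (x, z) = merge A B (y, z)" for B z
    by (auto simp: merge_def fun_eq_iff)
  then show ?thesis by (simp add: marg_def)
qed

text \<open>
  For a block \<open>A\<close> with end points \<open>a\<close> and \<open>b\<close> this is \<open>g_fun\<close>; the separate formulas for
  $\ell = k - 1$ and $\ell = k$ are the same expression, since \<open>marg \<nu> k {} f = 0\<close> for centred \<open>f\<close>.
\<close>

definition hoeffding_term ::
  "'a measure \<Rightarrow> nat \<Rightarrow> nat set \<Rightarrow> nat \<Rightarrow> nat \<Rightarrow> ((nat \<Rightarrow> 'a) \<Rightarrow> real) \<Rightarrow> (nat \<Rightarrow> 'a) \<Rightarrow> real" where
  "hoeffding_term \<nu> k A a b f = (\<lambda>x. marg \<nu> k A f x + marg \<nu> k (A - {a, b}) f x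
     - marg \<nu> k (A - {b}) f x - marg \<nu> k (A - {a}) f x)"

lemma hoeffding_term_cong:
  "(\<And>i. i \<in> A \<Longrightarrow> x i = y i) \<Longrightarrow> hoeffding_term \<nu> k A a b f x = hoeffding_term \<nu> k A a b f y"
  unfolding hoeffding_term_def by (intro arg_cong2[where f = "(+)"] arg_cong2[where f = "(-)"] marg_cong) auto

lemma hoeffding_term_commute: "hoeffding_term \<nu> k A a b f = hoeffding_term \<nu> k A b a f"
  by (simp add: hoeffding_term_def insert_commute fun_eq_iff)

context prob_space
begin

lemma marg_fibration:
  assumes "A \<subseteq> {1..k}"
  shows "fibration (PiM A (\<lambda>_. M)) (PiM ({1..k} - A) (\<lambda>_. M)) (pow_measure M k) (merge A ({1..k} - A))"
proof -
  have M: "prob_space M" by (rule prob_space_axioms)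
  interpret product_sigma_finite "\<lambda>_. M"
    unfolding product_sigma_finite_def using prob_space_imp_sigma_finite[OF M] by blast
  have A: "A \<union> ({1..k} - A) = {1..k}" "finite A" using assms finite_subset by auto
  have "measure_pres (PiM A (\<lambda>_. M) \<Otimes>\<^sub>M PiM ({1..k} - A) (\<lambda>_. M)) (pow_measure M k) (merge A ({1..k} - A))"
    using measurable_merge[of A "{1..k} - A" "\<lambda>_. M"] distr_merge[of A "{1..k} - A"] A
    unfolding measure_pres_def pow_measure_def by simp
  moreover have "prob_space (PiM I (\<lambda>_. M))" for I :: "nat set"
    using M by (intro prob_space_PiM)
  ultimately show ?thesis
    by (simp add: fibration_def fibration_axioms_def)
qed

text \<open>The marginal over A is regarded as a function on the larger product over A', so that all
  four marginals in a Hoeffding term live on one space.\<close>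

lemma
  assumes A: "A \<subseteq> A'" "A' \<subseteq> {1..k}" and f: "f \<in> L2 (pow_measure M k)"
  shows marg_L2: "marg M k A f \<in> L2 (PiM A' (\<lambda>_. M))"
    and AE_marg_fibre_L2:
      "AE x in PiM A' (\<lambda>_. M). (\<lambda>z. f (merge A ({1..k} - A) (x, z))) \<in> L2 (PiM ({1..k} - A) (\<lambda>_. M))"
proof -
  interpret fibration "PiM A (\<lambda>_. M)" "PiM ({1..k} - A) (\<lambda>_. M)" "pow_measure M k" "merge A ({1..k} - A)"
    using A by (intro marg_fibration) auto
  note pres = restrict_pres[OF A(1)]
  have eq: "marg M k A f = (\<lambda>x. avg f (restrict x A))"
    unfolding avg_def by (auto simp: fun_eq_iff marg_def merge_restrict)
  show "marg M k A f \<in> L2 (PiM A' (\<lambda>_. M))"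
    unfolding eq by (rule measure_pres_L2[OF pres avg_L2[OF f]])
  show "AE x in PiM A' (\<lambda>_. M). (\<lambda>z. f (merge A ({1..k} - A) (x, z))) \<in> L2 (PiM ({1..k} - A) (\<lambda>_. M))"
    using measure_pres_AE[OF pres AE_fibre_L2[OF f]] by simp
qed

text \<open>Fubini if a lies in A; otherwise the integrand is constant in \<xi>. Integrability is
  part of the claim because the four marginals of a Hoeffding term are integrated
  separately.\<close>

lemma marg_tower:
  assumes A: "A \<subseteq> A'" "A' \<subseteq> {1..k}" "a \<in> A'" and f: "f \<in> L2 (pow_measure M k)"
  shows "AE x in PiM A' (\<lambda>_. M). has_bochner_integral M (\<lambda>\<xi>. marg M k A f (x(a := \<xi>))) (marg M k (A - {a}) f x)"
proof (cases "a \<in> A")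
  case False
  then have A_eq: "A - {a} = A" by simp
  have eq: "marg M k A f (x(a := \<xi>)) = marg M k A f x" for x \<xi>
    by (rule marg_cong) (use False in auto)
  show ?thesis
    unfolding A_eq eq by (simp add: has_bochner_integral_iff prob_space)
next
  case True
  let ?B = "{1..k} - A"
  have B: "{1..k} - (A - {a}) = insert a ?B" using True A by auto
  \<comment> \<open>Coordinate a may be supplied by z or by x; this moves it out of the inner
    integral.\<close>
  have merge: "merge (A - {a}) (insert a ?B) (x, z(a := \<xi>)) = merge A ?B (x(a := \<xi>), z)" for x z and \<xi> :: 'a
    using True by (auto simp: merge_def fun_eq_iff)
  have "AE x in PiM A' (\<lambda>_. M). (\<lambda>z. f (merge (A - {a}) (insert a ?B) (x, z))) \<in> L2 (PiM (insert a ?B) (\<lambda>_. M))"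
    using AE_marg_fibre_L2[of "A - {a}" A' k f] A f unfolding B by auto
  then show ?thesis
  proof eventually_elim
    case (elim x)
    define F where "F = (\<lambda>z. f (merge (A - {a}) (insert a ?B) (x, z)))"
    have F_upd: "F (z(a := \<xi>)) = f (merge A ?B (x(a := \<xi>), z))" for z \<xi>
      by (simp only: F_def merge)
    have M: "prob_space M" by (rule prob_space_axioms)
    interpret R: prob_space "PiM (insert a ?B) (\<lambda>_. M)" by (rule PiM_prob)
    have F: "integrable (PiM (insert a ?B) (\<lambda>_. M)) F"
      using elim unfolding F_def by (rule R.L2_integrable)
    note pres = insert_pres[of ?B a]
    interpret B: prob_space "PiM ?B (\<lambda>_. M)" by (rule PiM_prob)
    interpret pair_prob_space "PiM ?B (\<lambda>_. M)" M ..
    have int: "integrable (PiM ?B (\<lambda>_. M) \<Otimes>\<^sub>M M) (\<lambda>(z, \<xi>). F (z(a := \<xi>)))"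
      using measure_pres_integrable[OF pres F] by (simp add: case_prod_beta')
    have "(\<integral>p. (\<lambda>(z, \<xi>). F (z(a := \<xi>))) p \<partial>(PiM ?B (\<lambda>_. M) \<Otimes>\<^sub>M M)) = (\<integral>z. F z \<partial>PiM (insert a ?B) (\<lambda>_. M))"
      using measure_pres_integral[OF pres borel_measurable_integrable[OF F]] by (simp add: case_prod_beta')
    also have "\<dots> = marg M k (A - {a}) f x"
      by (simp only: marg_def B F_def)
    finally have "has_bochner_integral M (\<lambda>\<xi>. \<integral>z. F (z(a := \<xi>)) \<partial>PiM ?B (\<lambda>_. M)) (marg M k (A - {a}) f x)"
      using integrable_snd[OF int] integral_snd[OF int] by (simp add: has_bochner_integral_iff)
    then show ?case
      by (simp only: F_upd marg_def)
  qed
qed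

lemma hoeffding_term_L2:
  assumes A: "A \<subseteq> {1..k}" and f: "f \<in> L2 (pow_measure M k)"
  shows "hoeffding_term M k A a b f \<in> L2 (PiM A (\<lambda>_. M))"
proof -
  have mem: "marg M k C f \<in> L2 (PiM A (\<lambda>_. M))" if "C \<subseteq> A" for C
    by (rule marg_L2[OF that A f])
  have "(\<lambda>x. 1 * (1 * marg M k A f x + 1 * marg M k (A - {a, b}) f x)
      + (-1) * (1 * marg M k (A - {b}) f x + 1 * marg M k (A - {a}) f x)) \<in> L2 (PiM A (\<lambda>_. M))"
    by (intro L2_lincomb mem) auto
  then show ?thesis
    by (simp add: hoeffding_term_def algebra_simps)
qed

text \<open>Integrating over a removes a from each of the four index sets, which leaves A - {a} and
  A - {a, b} twice each with opposite signs. The case a = b is the block of one point.\<close>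

lemma hoeffding_term_degenerate:
  assumes A: "A \<subseteq> {1..k}" "a \<in> A" and f: "f \<in> L2 (pow_measure M k)"
  shows "AE x in PiM A (\<lambda>_. M). (\<integral>\<xi>. hoeffding_term M k A a b f (x(a := \<xi>)) \<partial>M) = 0"
proof -
  have tower: "AE x in PiM A (\<lambda>_. M). has_bochner_integral M (\<lambda>\<xi>. marg M k C f (x(a := \<xi>))) (marg M k (C - {a}) f x)"
    if "C \<subseteq> A" for C
    by (rule marg_tower[OF that A f])
  have sets: "A - {a, b} - {a} = A - {a, b}" "A - {b} - {a} = A - {a, b}" "A - {a} - {a} = A - {a}"
    by auto
  from tower[OF subset_refl] tower[OF Diff_subset[of A "{a, b}"]] tower[OF Diff_subset[of A "{b}"]]
    tower[OF Diff_subset[of A "{a}"]]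
  show ?thesis
    unfolding sets by eventually_elim (simp add: hoeffding_term_def has_bochner_integral_iff)
qed

end

text \<open>With S l the sum of row l, the inner sum is the second difference S l - 2 S (l + 1) + S
  (l + 2) corrected by the end entries of rows l + 1 and l + 2; differences and corrections both
  telescope.\<close>

lemma telescope:
  fixes T :: "nat \<Rightarrow> nat \<Rightarrow> real"
  assumes "\<And>l i. k < l \<Longrightarrow> T l i = 0"
  shows "(\<Sum>l=1..k. \<Sum>i=1..l. T l i + T (l + 2) (i + 1) - T (l + 1) i - T (l + 1) (i + 1)) = T 1 1"
proof -
  define S where "S l = (\<Sum>i=1..l. T l i)" for l
  \<comment> \<open>The induction keeps the remaining boundary terms; for n = k their rows lie
    beyond k and vanish.\<close>
  have "(\<Sum>l=1..n. \<Sum>i=1..l. T l i + T (l + 2) (i + 1) - T (l + 1) i - T (l + 1) (i + 1))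
      = T 1 1 - S (n + 1) + S (n + 2) - T (n + 2) 1 - T (n + 2) (n + 2)" for n
  proof (induction n)
    case 0
    show ?case by (simp add: S_def numeral_2_eq_2)
  next
    case (Suc n)
    have shift: "(\<Sum>i=1..l. T r (i + 1)) = (\<Sum>i=1..l + 1. T r i) - T r 1" for l r
      by (induction l) auto
    have S2: "S (n + 2) = (\<Sum>i=1..n + 1. T (n + 2) i) + T (n + 2) (n + 2)"
      by (simp add: S_def)
    have S3: "S (n + 3) = (\<Sum>i=1..n + 2. T (n + 3) i) + T (n + 3) (n + 3)"
      by (simp add: S_def numeral_3_eq_3)
    have "(\<Sum>i=1..Suc n. T (Suc n) i + T (Suc n + 2) (i + 1) - T (Suc n + 1) i - T (Suc n + 1) (i + 1))
        = S (n + 1) + (\<Sum>i=1..n + 1. T (n + 3) (i + 1)) - (\<Sum>i=1..n + 1. T (n + 2) i)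
          - (\<Sum>i=1..n + 1. T (n + 2) (i + 1))"
      by (simp only: sum.distrib sum_subtractf S_def) (simp add: numeral_2_eq_2 numeral_3_eq_3)
    also have "\<dots> = S (n + 1) + (S (n + 3) - T (n + 3) (n + 3) - T (n + 3) 1)
        - (S (n + 2) - T (n + 2) (n + 2)) - (S (n + 2) - T (n + 2) 1)"
      unfolding shift S2 S3 by (simp add: S_def numeral_2_eq_2)
    finally show ?case
      using Suc by (simp add: numeral_2_eq_2 numeral_3_eq_3)
  qed
  then show ?thesis
    using assms by (simp add: S_def)
qed

section \<open>The components s_l: their sum and their membership in S_l\<close>

context window
begin

lemma marg_empty:
  assumes "f \<in> H"
  shows "marg \<nu> k {} f x = 0"
proof -
  have "merge {} {1..k} (x, z) = z" if "z \<in> space \<pi>" for z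
    using that by (auto simp: merge_def pow_measure_def space_PiM PiE_def extensional_def fun_eq_iff)
  then have "marg \<nu> k {} f x = (\<integral>z. f z \<partial>\<pi>)"
    unfolding marg_def pow_measure_def by (auto intro!: Bochner_Integration.integral_cong)
  then show ?thesis using H_D(2)[OF assms] by simp
qed

lemma marg_full:
  assumes "x \<in> space \<pi>"
  shows "marg \<nu> k {1..k} f x = f x"
proof -
  have "merge {1..k} {} (x, z) = x" for z
    using assms by (auto simp: merge_def pow_measure_def space_PiM PiE_def extensional_def fun_eq_iff)
  moreover have "measure (PiM {} (\<lambda>_::nat. \<nu>)) (space (PiM {} (\<lambda>_. \<nu>))) = 1"
    by (rule prob_space.prob_space[OF PiM_prob])
  ultimately show ?thesis
    by (simp add: marg_def)
qed

lemma sum_s_fun: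
  assumes "x \<in> space \<pi>"
  shows "(\<Sum>l=1..k. s_fun \<nu> k f l x) = f x"
proof -
  \<comment> \<open>Extending the marginals by 0 beyond l = k merges the three cases of
    \<open>g_fun\<close> into one formula.\<close>
  define T where "T l i = (if l \<le> k then marginal \<nu> k f l i x else 0)" for l i
  have "g_fun \<nu> k f l i x = T l i + T (l + 2) (i + 1) - T (l + 1) i - T (l + 1) (i + 1)" if "l \<in> {1..k}" for l i
    using that by (auto simp: g_fun_def T_def)
  then have "(\<Sum>l=1..k. s_fun \<nu> k f l x) = T 1 1"
    using telescope[of k T] by (simp add: s_fun_def T_def)
  also have "\<dots> = f x"
    using k_pos marg_full[OF assms] by (simp add: T_def marginal_eq_marg)
  finally show ?thesis .
qed

lemma g_fun_eq_hoeffding_term: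
  assumes f: "f \<in> H" and l: "l \<in> {1..k}"
  shows "g_fun \<nu> k f l i = hoeffding_term \<nu> k {i..i + k - l} i (i + k - l) f"
proof -
  consider "l = k" | "l + 1 = k" | "l + 2 \<le> k" using l by force
  then show ?thesis
  proof cases
    case 1
    then show ?thesis
      by (auto simp: g_fun_def hoeffding_term_def marginal_eq_marg marg_empty[OF f])
  next
    case 2
    then have "{i..i + k - l} = {i, i + 1}" "i + k - l = i + 1" by auto
    moreover have "{i, i + 1} - {i, i + 1} = {}" "{i, i + 1} - {i} = {i + 1}" "{i, i + 1} - {i + 1} = {i}" by auto
    moreover have "k - 1 = l" using 2 by simp
    ultimately show ?thesis
      using 2 unfolding g_fun_def hoeffding_term_def marginal_eq_marg
      by (auto simp: marg_empty[OF f])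
  next
    case 3
    have "{i + 1..i + 1 + k - (l + 2)} = {i..i + k - l} - {i, i + k - l}"
      "{i..i + k - (l + 1)} = {i..i + k - l} - {i + k - l}"
      "{i + 1..i + 1 + k - (l + 1)} = {i..i + k - l} - {i}"
      using 3 by auto
    then show ?thesis
      using 3 unfolding g_fun_def hoeffding_term_def marginal_eq_marg by auto
  qed
qed

lemma s_fun_S_space:
  assumes f: "f \<in> H" and l: "l \<in> {1..k}"
  shows "s_fun \<nu> k f l \<in> S_space \<nu> k l"
proof -
  define m where "m = k - l + 1"
  have lm: "1 \<le> l" "l \<le> k" "m = k - l + 1" using l by (auto simp: m_def)
  define A where "A i = {i..i + k - l}" for i
  \<comment> \<open>Carries a point indexed by {1..m} to the block A i, inverting the relabelling in
    \<open>block_fun\<close>: argument 1 becomes the left end i, argument m the right end i + k -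
    l.\<close>
  define r where "r i y = (\<lambda>n\<in>A i. y (n - i + 1))" for i and y :: "nat \<Rightarrow> 'a"
  define \<phi> where "\<phi> i y = g_fun \<nu> k f l i (r i y)" for i y
  have \<phi>: "\<phi> i \<in> degenerate \<nu> m" and block: "block_fun m i (\<phi> i) = g_fun \<nu> k f l i" if i: "i \<in> {1..l}" for i
  proof -
    let ?e = "i + k - l"
    let ?h = "hoeffding_term \<nu> k (A i) i ?e f"
    have g: "g_fun \<nu> k f l i = ?h"
      unfolding A_def by (rule g_fun_eq_hoeffding_term[OF f l])
    have A: "A i \<subseteq> {1..k}" "i \<in> A i" "?e \<in> A i"
      using i l by (auto simp: A_def)
    have fL: "f \<in> L2 \<pi>" by (rule H_D[OF f])
    have pres: "measure_pres (pow_measure \<nu> m) (PiM (A i) (\<lambda>_. \<nu>)) (r i)"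
      unfolding pow_measure_def r_def[abs_def] using l
      by (intro reindex_pres) (auto simp: inj_on_def A_def m_def)
    have "\<phi> i \<in> L2 (pow_measure \<nu> m)"
      unfolding \<phi>_def[abs_def] g
      by (rule measure_pres_L2[OF pres hoeffding_term_L2[OF A(1) fL]])
    moreover have "AE y in pow_measure \<nu> m. (\<integral>\<xi>. \<phi> i (y(1 := \<xi>)) \<partial>\<nu>) = 0"
    proof -
      have "r i (y(1 := \<xi>)) = (r i y)(i := \<xi>)" for y \<xi>
        using A(2) by (auto simp: r_def A_def fun_eq_iff)
      then show ?thesis
        using measure_pres_AE[OF pres hoeffding_term_degenerate[OF A(1,2) fL, of ?e]]
        by (simp add: \<phi>_def g)
    qed
    moreover have "AE y in pow_measure \<nu> m. (\<integral>\<xi>. \<phi> i (y(m := \<xi>)) \<partial>\<nu>) = 0"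
    proof -
      \<comment> \<open>At the right end the two end points exchange roles, which
        \<open>hoeffding_term_commute\<close> permits.\<close>
      have "r i (y(m := \<xi>)) = (r i y)(?e := \<xi>)" for y \<xi>
        using A(3) l by (auto simp: r_def A_def m_def fun_eq_iff)
      then show ?thesis
        using measure_pres_AE[OF pres hoeffding_term_degenerate[OF A(1,3) fL, of i]]
        by (simp add: \<phi>_def g hoeffding_term_commute[of \<nu> k "A i" i])
    qed
    ultimately show "\<phi> i \<in> degenerate \<nu> m"
      by (simp add: degenerate_def)
    show "block_fun m i (\<phi> i) = g_fun \<nu> k f l i"
      unfolding block_fun_def \<phi>_def g using i l
      by (intro ext hoeffding_term_cong) (auto simp: r_def A_def m_def)
  qed
  have eq: "s_fun \<nu> k f l = (\<lambda>x. \<Sum>i=1..l. block_fun m i (\<phi> i) x)"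
    unfolding s_fun_def by (intro ext sum.cong refl) (simp only: block)
  have "s_fun \<nu> k f l \<in> H"
    unfolding eq by (intro H_sum block_fun_H[OF lm] \<phi>)
  then show ?thesis
    unfolding S_space_iff[OF lm] using \<phi> by (intro conjI exI[of _ \<phi>]) (auto simp: eq)
qed

end

section \<open>Assembly of the orthogonal spectral decomposition\<close>

theorem theorem3p1:
  fixes \<nu> :: "'a measure" and k :: nat and f :: "(nat \<Rightarrow> 'a) \<Rightarrow> real"
  assumes "prob_space \<nu>" and "k \<ge> 1" and "f \<in> H_space \<nu> k"
  shows "(\<forall>l\<in>{1..k}. s_fun \<nu> k f l \<in> S_space \<nu> k l)
    \<and> (AE x in pow_measure \<nu> k. f x = (\<Sum>l=1..k. s_fun \<nu> k f l x))
    \<and> (\<forall>l\<in>{1..k}. \<exists>u\<in>L_space \<nu> k l. \<exists>v\<in>L0_space \<nu> k l.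
         AE x in pow_measure \<nu> k. s_fun \<nu> k f l x = u x + v x)
    \<and> (\<forall>F F0.
         (\<forall>l\<in>{1..k}. F l \<in> L_space \<nu> k l \<and> F0 l \<in> L0_space \<nu> k l \<and>
            (AE x in pow_measure \<nu> k. s_fun \<nu> k f l x = F l x + F0 l x))
         \<longrightarrow> (let f0 = (\<lambda>x. \<Sum>l=1..k. F0 l x) in
               (AE x in pow_measure \<nu> k. f x = f0 x + (\<Sum>l=1..k. F l x))
             \<and> f0 \<in> ker_B \<nu> k
             \<and> (\<forall>l\<in>{1..k}. F l \<in> L_space \<nu> k l)
             \<and> (\<forall>l\<in>{1..k}. L2_inner (pow_measure \<nu> k) f0 (F l) = 0)
             \<and> (\<forall>l\<in>{1..k}. \<forall>m\<in>{1..k}. l \<noteq> m \<longrightarrow>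
                  L2_inner (pow_measure \<nu> k) (F l) (F m) = 0)
             \<and> (AE x in pow_measure \<nu> k. s_fun \<nu> k f 1 x = F 1 x)))"
proof -
  interpret window \<nu> k
    using assms by (simp add: window_def window_axioms_def)
  note f = assms(3)
  have S: "s_fun \<nu> k f l \<in> S_space \<nu> k l" if "l \<in> {1..k}" for l
    by (rule s_fun_S_space[OF f that])
  have sum: "AE x in \<pi>. f x = (\<Sum>l=1..k. s_fun \<nu> k f l x)"
    by (rule AE_I2) (simp only: sum_s_fun)
  have decomp: "\<exists>u\<in>L_space \<nu> k l. \<exists>v\<in>L0_space \<nu> k l. AE x in \<pi>. s_fun \<nu> k f l x = u x + v x"
    if "l \<in> {1..k}" for l
    using S_space_decomp[OF _ _ refl S[OF that]] that by simp
  \<comment> \<open>Proved for every choice of components F and F0; \<open>decomp\<close> guarantees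
    that such components exist.\<close>
  have spectral: "(AE x in \<pi>. f x = (\<Sum>l=1..k. F0 l x) + (\<Sum>l=1..k. F l x))
      \<and> (\<lambda>x. \<Sum>l=1..k. F0 l x) \<in> ker_B \<nu> k
      \<and> (\<forall>l\<in>{1..k}. inn (\<lambda>x. \<Sum>l=1..k. F0 l x) (F l) = 0)
      \<and> (\<forall>l\<in>{1..k}. \<forall>m\<in>{1..k}. l \<noteq> m \<longrightarrow> inn (F l) (F m) = 0)
      \<and> (AE x in \<pi>. s_fun \<nu> k f 1 x = F 1 x)"
    if F: "\<forall>l\<in>{1..k}. F l \<in> L_space \<nu> k l \<and> F0 l \<in> L0_space \<nu> k l
      \<and> (AE x in \<pi>. s_fun \<nu> k f l x = F l x + F0 l x)" for F F0
  proof -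
    have FH: "F l \<in> H" and FB: "AE x in \<pi>. B_op \<nu> k (F l) x = real l * F l x"
      and F0S: "F0 l \<in> S_space \<nu> k l" and F0H: "F0 l \<in> H" and F0B: "AE x in \<pi>. B_op \<nu> k (F0 l) x = 0"
      if "l \<in> {1..k}" for l
      using F that by (auto simp: L_space_def L0_space_def ker_B_def)
    define f0 where "f0 = (\<lambda>x. \<Sum>l=1..k. F0 l x)"
    have f0H: "f0 \<in> H" unfolding f0_def by (rule H_sum[OF F0H])
    have eqs: "AE x in \<pi>. \<forall>l\<in>{1..k}. s_fun \<nu> k f l x = F l x + F0 l x"
      using F by (intro AE_finite_allI) auto
    have "AE x in \<pi>. f x = (\<Sum>l=1..k. F0 l x) + (\<Sum>l=1..k. F l x)"
      using sum eqs by eventually_elim (simp add: sum.distrib)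
    moreover have f0B: "AE x in \<pi>. B_op \<nu> k f0 x = 0"
    proof -
      have "AE x in \<pi>. \<forall>l\<in>{1..k}. B_op \<nu> k (F0 l) x = 0"
        using F0B by (intro AE_finite_allI) auto
      moreover have "AE x in \<pi>. B_op \<nu> k f0 x = (\<Sum>l=1..k. B_op \<nu> k (F0 l) x)"
        unfolding f0_def by (rule H_op_sum_AE[OF H_op_B F0H])
      ultimately show ?thesis
        by eventually_elim simp
    qed
    \<comment> \<open>The kernel is the eigenspace for 0, and l \<ge> 1 keeps the two eigenvalues
      apart.\<close>
    moreover have "inn f0 (F l) = 0" if "l \<in> {1..k}" for l
      using that by (intro eigenfunctions_orthogonal[of f0 0 "F l" "real l"] f0H FH FB) (use f0B in auto)
    moreover have "inn (F l) (F n) = 0" if "l \<in> {1..k}" "n \<in> {1..k}" "l \<noteq> n" for l n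
      using that by (intro eigenfunctions_orthogonal[of "F l" "real l" "F n" "real n"] FH FB) auto
    moreover have "AE x in \<pi>. s_fun \<nu> k f 1 x = F 1 x"
    proof -
      \<comment> \<open>B_k fixes \<open>F0 1\<close> as an element of S_1 and annihilates it as an
        element of the kernel, so \<open>F0 1\<close> is zero almost everywhere.\<close>
      have 1: "1 \<in> {1..k}" using k_pos by simp
      have "AE x in \<pi>. s_fun \<nu> k f 1 x = F 1 x + F0 1 x" using F 1 by blast
      with S_space_1[OF F0S[OF 1]] F0B[OF 1] show ?thesis
        by eventually_elim simp
    qed
    ultimately show ?thesis
      unfolding f0_def[symmetric] using f0H by (simp add: ker_B_def)
  qed
  show ?thesis
    unfolding Let_def
  proof (rule conjI[OF _ conjI[OF sum conjI]])
    show "\<forall>l\<in>{1..k}. s_fun \<nu> k f l \<in> S_space \<nu> k l"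
      using S by blast
  next
    show "\<forall>l\<in>{1..k}. \<exists>u\<in>L_space \<nu> k l. \<exists>v\<in>L0_space \<nu> k l. AE x in \<pi>. s_fun \<nu> k f l x = u x + v x"
      using decomp by blast
  qed (intro allI impI, frule spectral, blast)
qed

end
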